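(* Let $d\ge 1$, let $c\in(0,1]$, let $p$ be a finite-range probability distribution on $\mathbf{Z}^d$, and let $r:\mathbf{Z}_+\to[0,\infty)$ satisfy $0=r(0)<r(1)\le r(2)\le r(3)\le\cdots$ and $r(\infty)=\lim_{k\to\infty}r(k)<\infty$. For each choice of rates $\boldsymbol{\alpha}=(\alpha_x:x\in\mathbf{Z}^d)\in[c,1]^{\mathbf{Z}^d}$ and each $\varphi\in[0,r(\infty)c)$, let $\nu^{\boldsymbol{\alpha}}_\varphi$ be the product probability measure on $\mathcal{S}=\mathbf{Z}_+^{\mathbf{Z}^d}$ with marginals $$\nu^{\boldsymbol{\alpha}}_\varphi\bigl(\eta(x)=k\bigr)=\frac{1}{Z(\varphi/\alpha_x)}\,\frac{(\varphi/\alpha_x)^k}{r(1)\cdots r(k)},\qquad x\in\mathbf{Z}^d,\ k\in\mathbf{Z}_+,\qquad Z(\psi)=\sum_{k=0}^\infty\frac{\psi^k}{r(1)\cdots r(k)}.$$ Then $\nu^{\boldsymbol{\alpha}}_\varphi$ is invariant for the disordered zero-range process on $\mathbf{Z}^d$ with generator $$L^{\boldsymbol{\alpha}}f(\eta)=\sum_{x,y\in\mathbf{Z}^d}p(y-x)\,\alpha_x\, r(\eta(x))\,[f(\eta^{x,y})-f(\eta)].$$ That is, if the initial configuration $\eta(0)$ has distribution $\nu^{\boldsymbol{\alpha}}_\varphi$ (independently of the randomness driving the dynamics), then $\eta(t)$ has distribution $\nu^{\boldsymbol{\alpha}}_\varphi$ for every $t\ge 0$.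
   Context: $\mathbf{Z}_+=\{0,1,2,\ldots\}$. Finite range means: $p(x)\ge0$, $\sum_x p(x)=1$, and there is a fixed finite set $\mathcal{N}\subseteq\mathbf{Z}^d$ with $p(x)=0$ for $x\notin\mathcal{N}$. For $k=0$ the empty product $r(1)\cdots r(k)$ equals $1$, and $0^0=1$. For $\eta\in\mathcal{S}$, $\eta^{x,y}=\eta+\delta_y-\delta_x$, where $\delta_y(z)=1$ if $z=y$ and $0$ otherwise (so $\eta^{x,x}=\eta$); when $\eta(x)=0$ the corresponding term in the generator vanishes because $r(0)=0$. Informally, if $\eta(x)\ge1$ particles are at $x$, then at exponential rate $\alpha_x r(\eta(x))$ one particle leaves $x$ and goes to $y$ with probability $p(y-x)$, independently over sites. The process $\eta(t)=(\eta(x,t):x\in\mathbf{Z}^d)$, $t\ge0$, with fixed $\boldsymbol{\alpha}$ and arbitrary initial configuration $\eta\in\mathcal{S}$ is defined by the following graphical construction. Give each $x\in\mathbf{Z}^d$ an independent Poisson point process $\mathcal{T}^x$ of rate $r(\infty)$ on $(0,\infty)$. To the $i$th epoch of $\mathcal{T}^x$ attach a threshold $U^x_i$ uniform on $[0,r(\infty)]$ and a destination site $y^x_i$ with $P(y^x_i=y)=p(y-x)$, all independent of each other and of everything else. At an epoch $\tau$ of $\mathcal{T}^x$ with threshold $U$ and destination $y$: if $U\ge\alpha_x r(\eta(x,\tau-))$ nothing happens; if $U<\alpha_x r(\eta(x,\tau-))$ one particle is moved from $x$ to $y$, i.e. $\eta(\tau)=\eta(\tau-)+\delta_y-\delta_x$.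 The configuration changes at no other times. To make this well defined, fix $t_0>0$ small enough that the following random graph on $\mathbf{Z}^d$ almost surely has no infinite connected component (such $t_0$ exists): $x$ and $y$ are joined by an edge if $x-y$ or $y-x$ lies in $\mathcal{N}$ and at least one of $\mathcal{T}^x,\mathcal{T}^y$ has an epoch in $[0,t_0]$. Then, almost surely, on each (finite) connected component there are only finitely many epochs in $[0,t_0]$, and the rule above, applied to these epochs in temporal order, determines $\eta(t)$ on that component for $t\in[0,t_0]$. The construction is repeated on $[t_0,2t_0]$ starting from $\eta(t_0)$, and so on. The resulting process is a time-homogeneous Markov process with right-continuous paths with left limits in $\mathcal{S}$. *)

theory Defs
  imports "HOL-Probability.Probability"
begin

type_synonym 'd site = "(int, 'd) vec"
type_synonym 'd config = "'d site \<Rightarrow> nat"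

definition config_space :: "('d::finite) config measure" where
  "config_space = (\<Pi>\<^sub>M x\<in>UNIV. count_space UNIV)"


text \<open>The product measures\<close>

definition partition_fun :: "(nat \<Rightarrow> real) \<Rightarrow> real \<Rightarrow> real" where
  "partition_fun r \<psi> = (\<Sum>k. \<psi> ^ k / (\<Prod>i=1..k. r i))"

definition site_marginal :: "(nat \<Rightarrow> real) \<Rightarrow> real \<Rightarrow> nat measure" where
  "site_marginal r \<psi> = density (count_space UNIV)
     (\<lambda>k. ennreal (1 / partition_fun r \<psi> * (\<psi> ^ k / (\<Prod>i=1..k. r i))))"

definition zrp_product_measure ::
    "(nat \<Rightarrow> real) \<Rightarrow> (('d::finite) site \<Rightarrow> real) \<Rightarrow> real \<Rightarrow> 'd config measure" where
  "zrp_product_measure r \<alpha> \<phi> = (\<Pi>\<^sub>M x\<in>UNIV. site_marginal r (\<phi> / \<alpha> x))"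


text \<open>The driving randomness\<close>

text \<open>
  A Poisson point process of the given rate on the open half-line, enumerated increasingly
  as \<open>\<tau> 0 < \<tau> 1 < \<dots>\<close>. The Poisson weights are written out because \<^const>\<open>poisson_pmf\<close>
  is unspecified for parameter \<open>0\<close>, which occurs for null sets \<open>B\<close>.
\<close>

definition poisson_point_process :: "'w measure \<Rightarrow> real \<Rightarrow> (nat \<Rightarrow> 'w \<Rightarrow> real) \<Rightarrow> bool" where
  "poisson_point_process M rate \<tau> \<longleftrightarrow>
     (\<forall>i. \<tau> i \<in> borel_measurable M) \<and>
     (AE \<omega> in M. 0 < \<tau> 0 \<omega> \<and> strict_mono (\<lambda>i. \<tau> i \<omega>) \<and>
        filterlim (\<lambda>i. \<tau> i \<omega>) at_top sequentially) \<and>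
     (\<forall>B\<in>sets borel. B \<subseteq> {0<..} \<longrightarrow> bounded B \<longrightarrow>
        (\<forall>k. measure M {\<omega> \<in> space M. card {i. \<tau> i \<omega> \<in> B} = k} =
           (rate * measure lborel B) ^ k / fact k * exp (- (rate * measure lborel B)))) \<and>
     (\<forall>B :: nat \<Rightarrow> real set.
        (\<forall>j. B j \<in> sets borel \<and> B j \<subseteq> {0<..} \<and> bounded (B j)) \<longrightarrow> disjoint_family B \<longrightarrow>
        prob_space.indep_vars M (\<lambda>_. count_space UNIV) (\<lambda>j \<omega>. card {i. \<tau> i \<omega> \<in> B j}) UNIV)"

text \<open>
  The independent ingredients: the initial configuration, each whole sequence of epochs,
  each single threshold and each single destination. Since these have different types, their
  joint independence is expressed through the \<open>\<sigma>\<close>-algebras they generate.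
\<close>

datatype 'x ingredient = Initial | Epochs 'x | Threshold 'x nat | Destination 'x nat

fun ingredient_events ::
    "'w measure \<Rightarrow> ('w \<Rightarrow> ('d::finite) config) \<Rightarrow> ('d site \<Rightarrow> nat \<Rightarrow> 'w \<Rightarrow> real) \<Rightarrow>
     ('d site \<Rightarrow> nat \<Rightarrow> 'w \<Rightarrow> real) \<Rightarrow> ('d site \<Rightarrow> nat \<Rightarrow> 'w \<Rightarrow> 'd site) \<Rightarrow>
     'd site ingredient \<Rightarrow> 'w set set" where
  "ingredient_events M \<eta>0 T U Y Initial = sets (vimage_algebra (space M) \<eta>0 config_space)"
| "ingredient_events M \<eta>0 T U Y (Epochs x) =
     sets (vimage_algebra (space M) (\<lambda>\<omega> i. T x i \<omega>) (\<Pi>\<^sub>M i\<in>UNIV. borel))"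
| "ingredient_events M \<eta>0 T U Y (Threshold x i) = sets (vimage_algebra (space M) (U x i) borel)"
| "ingredient_events M \<eta>0 T U Y (Destination x i) =
     sets (vimage_algebra (space M) (Y x i) (count_space UNIV))"

definition zrp_randomness ::
    "'w measure \<Rightarrow> real \<Rightarrow> ('d::finite) site pmf \<Rightarrow> ('w \<Rightarrow> 'd config) \<Rightarrow>
     ('d site \<Rightarrow> nat \<Rightarrow> 'w \<Rightarrow> real) \<Rightarrow> ('d site \<Rightarrow> nat \<Rightarrow> 'w \<Rightarrow> real) \<Rightarrow>
     ('d site \<Rightarrow> nat \<Rightarrow> 'w \<Rightarrow> 'd site) \<Rightarrow> bool" where
  "zrp_randomness M r_inf p \<eta>0 T U Y \<longleftrightarrow>
     prob_space M \<and>
     \<eta>0 \<in> measurable M config_space \<and>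
     (\<forall>x. poisson_point_process M r_inf (T x)) \<and>
     (\<forall>x i. U x i \<in> borel_measurable M \<and>
        distr M borel (U x i) = uniform_measure lborel {0..r_inf}) \<and>
     (\<forall>x i. Y x i \<in> measurable M (count_space UNIV) \<and>
        (\<forall>y. measure M {\<omega> \<in> space M. Y x i \<omega> = y} = pmf p (y - x))) \<and>
     prob_space.indep_sets M (ingredient_events M \<eta>0 T U Y) UNIV"


text \<open>
  The graphical construction, for one realization \<open>\<tau>\<close>, \<open>u\<close>, \<open>dst\<close> of the epochs, thresholds
  and destinations.
\<close>

definition joined ::
    "('d::finite) site set \<Rightarrow> ('d site \<Rightarrow> nat \<Rightarrow> real) \<Rightarrow> real \<Rightarrow> real \<Rightarrow> 'd site \<Rightarrow> 'd site \<Rightarrow> bool"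
  where
  "joined \<N> \<tau> a b x y \<longleftrightarrow>
     (x - y \<in> \<N> \<or> y - x \<in> \<N>) \<and> (\<exists>i. \<tau> x i \<in> {a..b} \<or> \<tau> y i \<in> {a..b})"

definition component ::
    "('d::finite) site set \<Rightarrow> ('d site \<Rightarrow> nat \<Rightarrow> real) \<Rightarrow> real \<Rightarrow> real \<Rightarrow> 'd site \<Rightarrow> 'd site set" where
  "component \<N> \<tau> a b x = {y. (joined \<N> \<tau> a b)\<^sup>*\<^sup>* x y}"

text \<open>
  The configuration \<open>\<eta> + \<delta>\<^sub>y - \<delta>\<^sub>x\<close>. The truncated subtraction is harmless, as a
  particle is only moved away from \<open>x\<close> when \<open>\<eta> x > 0\<close>: thresholds are almost surely
  nonnegative and \<open>r 0 = 0\<close>.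
\<close>

definition move_particle :: "'x \<Rightarrow> 'x \<Rightarrow> ('x \<Rightarrow> nat) \<Rightarrow> 'x \<Rightarrow> nat" where
  "move_particle x y \<eta> = (\<lambda>z. \<eta> z + (if z = y then 1 else 0) - (if z = x then 1 else 0))"

definition epoch_update ::
    "(nat \<Rightarrow> real) \<Rightarrow> ('x \<Rightarrow> real) \<Rightarrow> ('x \<Rightarrow> nat \<Rightarrow> real) \<Rightarrow> ('x \<Rightarrow> nat \<Rightarrow> 'x) \<Rightarrow>
     'x \<times> nat \<Rightarrow> ('x \<Rightarrow> nat) \<Rightarrow> ('x \<Rightarrow> nat)" where
  "epoch_update r \<alpha> u dst = (\<lambda>(x, i) \<eta>.
     if u x i < \<alpha> x * r (\<eta> x) then move_particle x (dst x i) \<eta> else \<eta>)"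

definition in_temporal_order ::
    "('x \<Rightarrow> nat \<Rightarrow> real) \<Rightarrow> ('x \<times> nat) set \<Rightarrow> ('x \<times> nat) list \<Rightarrow> bool" where
  "in_temporal_order \<tau> E es \<longleftrightarrow>
     set es = E \<and> sorted_wrt (\<lambda>(x, i) (y, j). \<tau> x i < \<tau> y j) es"

text \<open>
  The configuration at time \<open>t \<in> [a, b]\<close> started from \<open>\<eta>\<close> at time \<open>a\<close>: the value at \<open>x\<close> is
  obtained by processing the epochs in \<open>(a, t]\<close> on the component of \<open>x\<close>, computed from all
  epochs in \<open>[a, b]\<close>. A list in temporal order is unique if it exists; it exists iff these
  epochs are finitely many and occur at distinct times. The value \<open>\<eta> x\<close> chosen otherwise
  is arbitrary.
\<close>

definition zrp_step ::
    "('d::finite) site set \<Rightarrow> (nat \<Rightarrow> real) \<Rightarrow> ('d site \<Rightarrow> real) \<Rightarrow>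
     ('d site \<Rightarrow> nat \<Rightarrow> real) \<Rightarrow> ('d site \<Rightarrow> nat \<Rightarrow> real) \<Rightarrow> ('d site \<Rightarrow> nat \<Rightarrow> 'd site) \<Rightarrow>
     real \<Rightarrow> real \<Rightarrow> real \<Rightarrow> 'd config \<Rightarrow> 'd config" where
  "zrp_step \<N> r \<alpha> \<tau> u dst a b t \<eta> = (\<lambda>x.
     let E = {(y, i). y \<in> component \<N> \<tau> a b x \<and> \<tau> y i \<in> {a<..t}}
     in if \<exists>es. in_temporal_order \<tau> E es
        then fold (epoch_update r \<alpha> u dst) (THE es. in_temporal_order \<tau> E es) \<eta> x
        else \<eta> x)"

primrec zrp_grid ::
    "real \<Rightarrow> ('d::finite) site set \<Rightarrow> (nat \<Rightarrow> real) \<Rightarrow> ('d site \<Rightarrow> real) \<Rightarrow>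
     ('d site \<Rightarrow> nat \<Rightarrow> real) \<Rightarrow> ('d site \<Rightarrow> nat \<Rightarrow> real) \<Rightarrow> ('d site \<Rightarrow> nat \<Rightarrow> 'd site) \<Rightarrow>
     'd config \<Rightarrow> nat \<Rightarrow> 'd config" where
  "zrp_grid t0 \<N> r \<alpha> \<tau> u dst \<eta> 0 = \<eta>"
| "zrp_grid t0 \<N> r \<alpha> \<tau> u dst \<eta> (Suc k) =
     zrp_step \<N> r \<alpha> \<tau> u dst (real k * t0) (real (Suc k) * t0) (real (Suc k) * t0)
       (zrp_grid t0 \<N> r \<alpha> \<tau> u dst \<eta> k)"

definition zrp ::
    "real \<Rightarrow> ('d::finite) site set \<Rightarrow> (nat \<Rightarrow> real) \<Rightarrow> ('d site \<Rightarrow> real) \<Rightarrow>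
     ('d site \<Rightarrow> nat \<Rightarrow> real) \<Rightarrow> ('d site \<Rightarrow> nat \<Rightarrow> real) \<Rightarrow> ('d site \<Rightarrow> nat \<Rightarrow> 'd site) \<Rightarrow>
     'd config \<Rightarrow> real \<Rightarrow> 'd config" where
  "zrp t0 \<N> r \<alpha> \<tau> u dst \<eta> t =
     (let k = nat \<lfloor>t / t0\<rfloor>
      in zrp_step \<N> r \<alpha> \<tau> u dst (real k * t0) (real (Suc k) * t0) t
           (zrp_grid t0 \<N> r \<alpha> \<tau> u dst \<eta> k))"

end

theory Submission
  imports Defs
begin

text \<open>
  On a finite set \<open>\<Lambda>\<close> of sites, modify the destinations so that every displacement acts as a
  permutation of \<open>\<Lambda>\<close>. The identity \<open>\<alpha> x * r (k + 1) * \<nu>(k + 1) = \<phi> * \<nu>(k)\<close> for the marginals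
  shows that the product measure on \<open>\<Lambda>\<close> is then invariant under one update at a uniformly
  chosen site of \<open>\<Lambda>\<close>.

  Cut \<open>(0, t]\<close> into \<open>m\<close> equal cells. If no cell contains two epochs of sites in \<open>\<Lambda>\<close>, the temporal
  order of the epochs, with their indices, is determined by the list recording for each cell the
  site of its epoch, if any. The probability of such a list depends only on its number
  of epochs, so averaging over the lists amounts to updating at independent uniform sites. Hence the
  modified process has any given value \<open>\<xi>\<close> at time \<open>t\<close> with probability at least \<open>\<nu>(\<xi>)\<close> times the
  probability that no cell contains two epochs. Letting \<open>m \<longrightarrow> \<infinity>\<close> gives a lower bound by \<open>\<nu>\<close>, and
  two probability measures that are ordered coincide.

  Finally, at each site the modified process agrees with the graphical construction once \<open>\<Lambda>\<close> is
  large, because the components are finite. The hypothesis yields this only on \<open>[0, t0]\<close>; it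
  carries over to later time blocks since the events that a site has an epoch in the block are
  independent over the sites and have the same probability for all blocks.
\<close>

section \<open>Pathwise comparison of the modified and the original dynamics\<close>

text \<open>Under the marginal at x the mean of \<open>\<alpha> x * r (\<eta> x)\<close> is \<phi>,
  whatever \<alpha> x is. Hence inflow and outflow of the sites balance as soon as the jump law is
  doubly stochastic; restricting p to a finite set destroys this property and the permutations
  restore it. The price is a wrong destination near the boundary, which must be kept out of the
  component under observation. The second obstacle is that the epochs live in continuous time,
  whereas the kernels act along a list of sites. Fixing the record of the cells makes the list of
  epochs deterministic: the thresholds and destinations that are read are then a fixed list of
  distinct variables, independent of the epochs and of the initial configuration, so the final law
  is a composition of kernels and no conditioning on epoch times occurs. Records with a crowded cell
  are dropped, which is why lower bounds come first. The same estimate also yields the almost sure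
  existence of a temporal order.\<close>

lemma sorted_wrt_asym_unique:
  assumes "\<And>a b. P a b \<Longrightarrow> \<not> P b a"
  shows "sorted_wrt P xs \<Longrightarrow> sorted_wrt P ys \<Longrightarrow> set xs = set ys \<Longrightarrow> xs = ys"
proof (induction xs arbitrary: ys)
  case (Cons a xs)
  then obtain b ys' where ys: "ys = b # ys'" by (cases ys) auto
  have "a = b"
  proof (rule ccontr)
    assume "a \<noteq> b"
    then have "a \<in> set ys'" "b \<in> set xs"
      using Cons.prems(3) unfolding ys by auto
    then show False
      using Cons.prems(1,2) assms unfolding ys sorted_wrt.simps by blast
  qed
  moreover have "a \<notin> set xs" "b \<notin> set ys'"
    using Cons.prems assms[of a a] assms[of b b] unfolding ys by auto
  ultimately have "set xs = set ys'"
    using Cons.prems(3) unfolding ys by auto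
  then show ?case
    using Cons \<open>a = b\<close> unfolding ys by auto
qed simp

lemma in_temporal_order_unique:
  assumes "in_temporal_order \<tau> E es" "in_temporal_order \<tau> E es'"
  shows "es = es'"
  using assms unfolding in_temporal_order_def
  by (intro sorted_wrt_asym_unique[where P = "\<lambda>(x, i) (y, j). \<tau> x i < \<tau> y j"]) auto

lemma in_temporal_order_filter:
  assumes "in_temporal_order \<tau> E es"
  shows "in_temporal_order \<tau> {e \<in> E. P e} (filter P es)"
  using assms by (auto simp: in_temporal_order_def sorted_wrt_filter)

lemma in_temporal_order_subset:
  assumes "in_temporal_order \<tau> E es" "E' \<subseteq> E"
  shows "\<exists>es'. in_temporal_order \<tau> E' es'"
proof -
  have "{e \<in> E. e \<in> E'} = E'" using assms(2) by auto
  then show ?thesis using in_temporal_order_filter[OF assms(1), of "\<lambda>e. e \<in> E'"] by metis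
qed

lemma in_temporal_order_append:
  assumes "in_temporal_order \<tau> E es" "in_temporal_order \<tau> F fs"
    and "\<And>x i y j. (x, i) \<in> E \<Longrightarrow> (y, j) \<in> F \<Longrightarrow> \<tau> x i < \<tau> y j"
  shows "in_temporal_order \<tau> (E \<union> F) (es @ fs)"
  using assms by (auto simp: in_temporal_order_def sorted_wrt_append)

text \<open>The inner loop of \<open>zrp_step\<close> with the set of epochs as a parameter. The
  original dynamics, read at one site, and the modified dynamics become instances of it with
  different epoch sets and destinations.\<close>

definition run_epochs ::
    "(nat \<Rightarrow> real) \<Rightarrow> ('x \<Rightarrow> real) \<Rightarrow> ('x \<Rightarrow> nat \<Rightarrow> real) \<Rightarrow> ('x \<Rightarrow> nat \<Rightarrow> real) \<Rightarrow>
     ('x \<Rightarrow> nat \<Rightarrow> 'x) \<Rightarrow> ('x \<times> nat) set \<Rightarrow> ('x \<Rightarrow> nat) \<Rightarrow> ('x \<Rightarrow> nat)" where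
  "run_epochs r \<alpha> \<tau> u dst E \<eta> =
     (if \<exists>es. in_temporal_order \<tau> E es
      then fold (epoch_update r \<alpha> u dst) (THE es. in_temporal_order \<tau> E es) \<eta> else \<eta>)"

lemma run_epochs_eq:
  assumes "in_temporal_order \<tau> E es"
  shows "run_epochs r \<alpha> \<tau> u dst E \<eta> = fold (epoch_update r \<alpha> u dst) es \<eta>"
proof -
  have "(THE es. in_temporal_order \<tau> E es) = es"
    using assms in_temporal_order_unique by blast
  then show ?thesis using assms by (auto simp: run_epochs_def)
qed

lemma zrp_step_eq_run_epochs:
  "zrp_step \<N> r \<alpha> \<tau> u dst a b t \<eta> x =
     run_epochs r \<alpha> \<tau> u dst {(y, i). y \<in> component \<N> \<tau> a b x \<and> \<tau> y i \<in> {a<..t}} \<eta> x"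
  unfolding zrp_step_def run_epochs_def Let_def by (rule if_distrib[where f = "\<lambda>f. f x", symmetric])

definition epochs_in :: "'x set \<Rightarrow> ('x \<Rightarrow> nat \<Rightarrow> real) \<Rightarrow> real \<Rightarrow> real \<Rightarrow> ('x \<times> nat) set" where
  "epochs_in \<Lambda> \<tau> a t = {(y, i). y \<in> \<Lambda> \<and> \<tau> y i \<in> {a<..t}}"

text \<open>The flow property: every epoch up to b precedes every epoch after b, so the two ordered
  lists concatenate.\<close>

lemma run_epochs_split:
  assumes "\<exists>es. in_temporal_order \<tau> (epochs_in \<Lambda> \<tau> a c) es" "a \<le> b" "b \<le> c"
  shows "run_epochs r \<alpha> \<tau> u dst (epochs_in \<Lambda> \<tau> a c) \<eta> =
    run_epochs r \<alpha> \<tau> u dst (epochs_in \<Lambda> \<tau> b c) (run_epochs r \<alpha> \<tau> u dst (epochs_in \<Lambda> \<tau> a b) \<eta>)"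
proof -
  have sub: "epochs_in \<Lambda> \<tau> a b \<subseteq> epochs_in \<Lambda> \<tau> a c" "epochs_in \<Lambda> \<tau> b c \<subseteq> epochs_in \<Lambda> \<tau> a c"
    and un: "epochs_in \<Lambda> \<tau> a c = epochs_in \<Lambda> \<tau> a b \<union> epochs_in \<Lambda> \<tau> b c"
    using assms by (auto simp: epochs_in_def)
  obtain es fs where *: "in_temporal_order \<tau> (epochs_in \<Lambda> \<tau> a b) es"
    "in_temporal_order \<tau> (epochs_in \<Lambda> \<tau> b c) fs"
    using assms(1) in_temporal_order_subset sub by metis
  have "in_temporal_order \<tau> (epochs_in \<Lambda> \<tau> a c) (es @ fs)"
    unfolding un by (rule in_temporal_order_append[OF *]) (auto simp: epochs_in_def)
  from run_epochs_eq[OF this] run_epochs_eq[OF *(1)] run_epochs_eq[OF *(2)]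
  show ?thesis by simp
qed

text \<open>A site of \<open>C\<close> is affected only by epochs at sites of \<open>C\<close>,
  whose thresholds are compared with values in \<open>C\<close>, and by arrivals from outside, which
  the second hypothesis excludes. Dropping the epochs outside \<open>C\<close> therefore leaves the
  values in \<open>C\<close> unchanged.\<close>

lemma fold_epoch_update_local:
  assumes "\<And>y i. (y, i) \<in> set es \<Longrightarrow> y \<in> C \<Longrightarrow> d y i = d' y i"
    and "\<And>y i. (y, i) \<in> set es \<Longrightarrow> y \<notin> C \<Longrightarrow> d y i \<notin> C"
    and "\<And>z. z \<in> C \<Longrightarrow> \<eta> z = \<eta>' z" and "z \<in> C"
  shows "fold (epoch_update r \<alpha> u d) es \<eta> z =
    fold (epoch_update r \<alpha> u d') (filter (\<lambda>e. fst e \<in> C) es) \<eta>' z"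
  using assms
proof (induction es arbitrary: \<eta> \<eta>')
  case (Cons e es)
  obtain y i where e: "e = (y, i)" by (cases e)
  have 1: "epoch_update r \<alpha> u d e \<eta> z = epoch_update r \<alpha> u d' e \<eta>' z" if "z \<in> C" "y \<in> C" for z
    using Cons.prems(1)[of y i] Cons.prems(3)[of z] Cons.prems(3)[of y] that
    by (auto simp: e epoch_update_def move_particle_def)
  have 2: "epoch_update r \<alpha> u d e \<eta> z = \<eta>' z" if "z \<in> C" "y \<notin> C" for z
    using Cons.prems(2)[of y i] Cons.prems(3)[of z] that
    by (auto simp: e epoch_update_def move_particle_def)
  show ?case
  proof (cases "y \<in> C")
    case True
    then show ?thesis using 1 Cons.prems by (auto simp: e intro!: Cons.IH)
  next
    case False
    then show ?thesis using 2 Cons.prems by (auto simp: e intro!: Cons.IH)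
  qed
qed simp

section \<open>Permutations of a finite set that extend translations\<close>

lemma finite_partial_injection_extends:
  assumes "finite A" "B \<subseteq> A" "inj_on g B" "g ` B \<subseteq> A"
  shows "\<exists>f. bij_betw f A A \<and> (\<forall>x\<in>B. f x = g x)"
proof -
  have fin: "finite B" "finite (A - B)" "finite (A - g ` B)"
    using assms finite_subset by auto
  have "card (A - B) = card (A - g ` B)"
    using assms fin by (simp add: card_Diff_subset card_image)
  then obtain h where h: "bij_betw h (A - B) (A - g ` B)"
    using finite_same_card_bij fin by blast
  have "bij_betw (\<lambda>x. if x \<in> B then g x else h x) (B \<union> (A - B)) (g ` B \<union> (A - g ` B))"
  proof (rule bij_betw_combine)
    show "bij_betw (\<lambda>x. if x \<in> B then g x else h x) B (g ` B)"
      using assms(3) bij_betw_cong[of B "\<lambda>x. if x \<in> B then g x else h x" g]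
      by (auto simp: bij_betw_imageI)
    show "bij_betw (\<lambda>x. if x \<in> B then g x else h x) (A - B) (A - g ` B)"
      using h bij_betw_cong[of "A - B" "\<lambda>x. if x \<in> B then g x else h x" h] by auto
  qed auto
  moreover have "B \<union> (A - B) = A" "g ` B \<union> (A - g ` B) = A" using assms by auto
  ultimately show ?thesis by (intro exI[of _ "\<lambda>x. if x \<in> B then g x else h x"]) auto
qed

text \<open>
  Particles leaving the finite set \<open>\<Lambda>\<close> are sent back into it so that every displacement
  acts as a permutation of \<open>\<Lambda>\<close>; this makes the jump kernel on \<open>\<Lambda>\<close> doubly stochastic.
\<close>

definition box_shift :: "('x::ab_group_add) set \<Rightarrow> 'x \<Rightarrow> 'x \<Rightarrow> 'x" where
  "box_shift \<Lambda> n = (SOME f. bij_betw f \<Lambda> \<Lambda> \<and> (\<forall>x\<in>\<Lambda>. x + n \<in> \<Lambda> \<longrightarrow> f x = x + n))"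

lemma
  assumes "finite \<Lambda>"
  shows bij_betw_box_shift: "bij_betw (box_shift \<Lambda> n) \<Lambda> \<Lambda>"
    and box_shift_eq: "x \<in> \<Lambda> \<Longrightarrow> x + n \<in> \<Lambda> \<Longrightarrow> box_shift \<Lambda> n x = x + n"
proof -
  have "\<exists>f. bij_betw f \<Lambda> \<Lambda> \<and> (\<forall>x\<in>{x\<in>\<Lambda>. x + n \<in> \<Lambda>}. f x = x + n)"
    using assms by (intro finite_partial_injection_extends) (auto simp: inj_on_def)
  then have "\<exists>f. bij_betw f \<Lambda> \<Lambda> \<and> (\<forall>x\<in>\<Lambda>. x + n \<in> \<Lambda> \<longrightarrow> f x = x + n)" by blast
  from someI_ex[OF this]
  show "bij_betw (box_shift \<Lambda> n) \<Lambda> \<Lambda>"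
    "x \<in> \<Lambda> \<Longrightarrow> x + n \<in> \<Lambda> \<Longrightarrow> box_shift \<Lambda> n x = x + n"
    unfolding box_shift_def by auto
qed

text \<open>If the translation by n takes x out of \<Lambda>, injectivity keeps the redirected image
  away from every site that is already the translate of a site of \<Lambda>. Redirected particles
  thus arrive only near the boundary, at sites z with \<open>z - n\<close> outside \<Lambda>, and
  never in a component whose \<N>-neighbourhood lies in \<Lambda>.\<close>

lemma box_shift_minus_notin:
  assumes "finite \<Lambda>" "x \<in> \<Lambda>" "x + n \<notin> \<Lambda>"
  shows "box_shift \<Lambda> n x - n \<notin> \<Lambda>"
proof
  let ?y = "box_shift \<Lambda> n x - n"
  assume y: "?y \<in> \<Lambda>"
  have "box_shift \<Lambda> n x \<in> \<Lambda>"
    using bij_betw_box_shift[OF assms(1)] assms(2) by (auto simp: bij_betw_def)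
  then have "box_shift \<Lambda> n ?y = box_shift \<Lambda> n x"
    using box_shift_eq[OF assms(1) y, of n] by simp
  then have "?y = x"
    using bij_betw_box_shift[OF assms(1), of n] y assms(2) by (auto simp: bij_betw_def inj_on_def)
  then have "x + n = box_shift \<Lambda> n x" by (simp add: algebra_simps)
  then show False using \<open>box_shift \<Lambda> n x \<in> \<Lambda>\<close> assms(3) by simp
qed

definition box_dst :: "('x::ab_group_add) set \<Rightarrow> ('x \<Rightarrow> nat \<Rightarrow> 'x) \<Rightarrow> 'x \<Rightarrow> nat \<Rightarrow> 'x" where
  "box_dst \<Lambda> dst y i = box_shift \<Lambda> (dst y i - y) y"

section \<open>Agreement of the two dynamics on finite components\<close>

lemma component_step:
  assumes "y \<in> component \<N> \<tau> a b x" "joined \<N> \<tau> a b y z"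
  shows "z \<in> component \<N> \<tau> a b x"
  using assms by (auto simp: component_def intro: rtranclp.rtrancl_into_rtrancl)

text \<open>Two reasons keep particles of other sites out of the component \<open>C\<close>. A true
  jump from an epoch outside \<open>C\<close> into \<open>C\<close> would run along an edge of the
  graph, because the epoch itself opens that edge; a redirected jump ends at a site whose
  \<N>-neighbourhood leaves \<Lambda>. For epochs in \<open>C\<close> no redirection takes
  place.\<close>

lemma box_run_eq_zrp_step:
  fixes \<N> :: "('d::finite) site set" and \<tau> :: "'d site \<Rightarrow> nat \<Rightarrow> real"
  assumes \<Lambda>: "finite \<Lambda>" and C: "C = component \<N> \<tau> a b x" "C \<subseteq> \<Lambda>"
    and nbhd: "\<And>y n. y \<in> C \<Longrightarrow> n \<in> \<N> \<Longrightarrow> y + n \<in> \<Lambda> \<and> y - n \<in> \<Lambda>"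
    and dst: "\<And>y i. dst y i - y \<in> \<N>"
    and ord: "\<exists>es. in_temporal_order \<tau> (epochs_in \<Lambda> \<tau> a t) es" and "t \<le> b"
    and \<eta>: "\<And>y. y \<in> C \<Longrightarrow> \<eta> y = \<eta>' y"
  shows "run_epochs r \<alpha> \<tau> u (box_dst \<Lambda> dst) (epochs_in \<Lambda> \<tau> a t) \<eta> x =
    zrp_step \<N> r \<alpha> \<tau> u dst a b t \<eta>' x"
proof -
  obtain es where es: "in_temporal_order \<tau> (epochs_in \<Lambda> \<tau> a t) es" using ord by blast
  let ?fs = "filter (\<lambda>e. fst e \<in> C) es"
  have "{e \<in> epochs_in \<Lambda> \<tau> a t. fst e \<in> C} =
      {(y, i). y \<in> component \<N> \<tau> a b x \<and> \<tau> y i \<in> {a<..t}}"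
    using C by (auto simp: epochs_in_def)
  then have fs: "in_temporal_order \<tau> {(y, i). y \<in> component \<N> \<tau> a b x \<and> \<tau> y i \<in> {a<..t}} ?fs"
    using in_temporal_order_filter[OF es, of "\<lambda>e. fst e \<in> C"] by simp
  have mem: "y \<in> \<Lambda> \<and> \<tau> y i \<in> {a..b}" if "(y, i) \<in> set es" for y i
    using es that \<open>t \<le> b\<close> by (auto simp: in_temporal_order_def epochs_in_def)
  have "fold (epoch_update r \<alpha> u (box_dst \<Lambda> dst)) es \<eta> x =
      fold (epoch_update r \<alpha> u dst) ?fs \<eta>' x"
  proof (rule fold_epoch_update_local)
    show "x \<in> C" by (simp add: C component_def)
  next
    fix y i assume "(y, i) \<in> set es" "y \<in> C"
    then show "box_dst \<Lambda> dst y i = dst y i"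
      using nbhd[of y "dst y i - y"] dst[of y i] C(2)
      by (auto simp: box_dst_def box_shift_eq[OF \<Lambda>])
  next
    fix y i assume e: "(y, i) \<in> set es" "y \<notin> C"
    show "box_dst \<Lambda> dst y i \<notin> C"
    proof (cases "dst y i \<in> \<Lambda>")
      case True
      then have "box_dst \<Lambda> dst y i = dst y i"
        using mem[OF e(1)] by (auto simp: box_dst_def box_shift_eq[OF \<Lambda>])
      moreover have "joined \<N> \<tau> a b (dst y i) y"
        using mem[OF e(1)] dst[of y i] by (auto simp: joined_def)
      ultimately show ?thesis
        using component_step[of "dst y i" \<N> \<tau> a b x y] e(2) C by auto
    next
      case False
      then have "box_dst \<Lambda> dst y i - (dst y i - y) \<notin> \<Lambda>"
        using box_shift_minus_notin[OF \<Lambda>, of y "dst y i - y"] mem[OF e(1)] by (auto simp: box_dst_def)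
      then show ?thesis using nbhd dst by blast
    qed
  qed (use \<eta> in auto)
  then show ?thesis
    by (simp only: zrp_step_eq_run_epochs run_epochs_eq[OF es] run_epochs_eq[OF fs])
qed

text \<open>Within a block, the value at x depends on the values at the start of the block only
  through one finite component, so the induction over blocks asks for agreement at finitely many
  sites each time. How large L must be may vary with the site.\<close>

lemma box_run_eventually_eq_zrp:
  fixes \<N> :: "('d::finite) site set" and \<tau> :: "'d site \<Rightarrow> nat \<Rightarrow> real"
    and \<Lambda> :: "nat \<Rightarrow> 'd site set"
  assumes \<Lambda>: "\<And>L. finite (\<Lambda> L)" "\<And>x. eventually (\<lambda>L. x \<in> \<Lambda> L) sequentially"
    and \<N>: "finite \<N>" and dst: "\<And>y i. dst y i - y \<in> \<N>"
    and comp: "\<And>k x. finite (component \<N> \<tau> (real k * t0) (real (Suc k) * t0) x)"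
    and ord: "\<And>L s. \<exists>es. in_temporal_order \<tau> (epochs_in (\<Lambda> L) \<tau> 0 s) es"
    and init: "\<And>x. eventually (\<lambda>L. \<eta>L L x = \<eta> x) sequentially"
    and t0: "0 < t0" and t: "0 \<le> t"
  shows "eventually (\<lambda>L. run_epochs r \<alpha> \<tau> u (box_dst (\<Lambda> L) dst) (epochs_in (\<Lambda> L) \<tau> 0 t) (\<eta>L L) x =
    zrp t0 \<N> r \<alpha> \<tau> u dst \<eta> t x) sequentially"
proof -
  define X where "X L s = run_epochs r \<alpha> \<tau> u (box_dst (\<Lambda> L) dst) (epochs_in (\<Lambda> L) \<tau> 0 s) (\<eta>L L)" for L s
  have step: "eventually (\<lambda>L. X L s x = zrp_step \<N> r \<alpha> \<tau> u dst a b s \<eta>' x) sequentially"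
    if C: "finite (component \<N> \<tau> a b x)" and "0 \<le> a" "a \<le> s" "s \<le> b"
      and IH: "\<And>y. eventually (\<lambda>L. X L a y = \<eta>' y) sequentially" for a b s x \<eta>'
  proof -
    let ?C = "component \<N> \<tau> a b x"
    \<comment> \<open>The component together with its \<N>-neighbourhood, as
      \<open>box_run_eq_zrp_step\<close> requires.\<close>
    let ?D = "?C \<union> (\<Union>y\<in>?C. \<Union>n\<in>\<N>. {y + n, y - n})"
    have "eventually (\<lambda>L. \<forall>y\<in>?C. X L a y = \<eta>' y) sequentially"
      using C IH by (intro eventually_ball_finite) auto
    moreover have "eventually (\<lambda>L. \<forall>y\<in>?D. y \<in> \<Lambda> L) sequentially"
      using C \<Lambda>(2) \<N> by (intro eventually_ball_finite) auto
    ultimately show ?thesis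
    proof eventually_elim
      case (elim L)
      have "\<exists>es. in_temporal_order \<tau> (epochs_in (\<Lambda> L) \<tau> a s) es"
        using ord[of L s] \<open>0 \<le> a\<close>
        by (auto simp: epochs_in_def elim!: in_temporal_order_subset)
      then have "run_epochs r \<alpha> \<tau> u (box_dst (\<Lambda> L) dst) (epochs_in (\<Lambda> L) \<tau> a s) (X L a) x =
          zrp_step \<N> r \<alpha> \<tau> u dst a b s \<eta>' x"
        using elim dst \<Lambda> \<open>s \<le> b\<close> by (intro box_run_eq_zrp_step) auto
      then show ?case
        using run_epochs_split[OF ord[of L s] \<open>0 \<le> a\<close> \<open>a \<le> s\<close>] by (simp add: X_def)
    qed
  qed
  have grid: "eventually (\<lambda>L. X L (real k * t0) x = zrp_grid t0 \<N> r \<alpha> \<tau> u dst \<eta> k x) sequentially"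
    for k x
  proof (induction k arbitrary: x)
    case 0
    have "in_temporal_order \<tau> (epochs_in (\<Lambda> L) \<tau> 0 0) []" for L
      by (auto simp: in_temporal_order_def epochs_in_def)
    then have "X L 0 = \<eta>L L" for L
      using run_epochs_eq by (fastforce simp: X_def)
    then show ?case using init by simp
  next
    case (Suc k)
    show ?case
      unfolding zrp_grid.simps
      by (rule step[OF comp]) (use t0 Suc in \<open>auto simp: field_simps\<close>)
  qed
  define k where "k = nat \<lfloor>t / t0\<rfloor>"
  have "real k = of_int \<lfloor>t / t0\<rfloor>"
    using t t0 by (simp add: k_def)
  then have "real k \<le> t / t0" "t / t0 < real k + 1"
    by linarith+
  then have "real k * t0 \<le> t" "t \<le> real (Suc k) * t0"
    using t0 by (auto simp: field_simps)
  then have "eventually (\<lambda>L. X L t x = zrp_step \<N> r \<alpha> \<tau> u dst (real k * t0) (real (Suc k) * t0) t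
      (zrp_grid t0 \<N> r \<alpha> \<tau> u dst \<eta> k) x) sequentially"
    using t0 grid by (intro step comp) auto
  then show ?thesis by (simp add: zrp_def Let_def k_def X_def)
qed

section \<open>Reading the ordered epochs off a record of time cells\<close>

text \<open>The \<open>j\<close>-th entry of \<open>s\<close> is the site of the epoch in the \<open>j\<close>-th time cell, if there is one.\<close>

definition label_epochs :: "'x option list \<Rightarrow> ('x \<times> nat) list" where
  "label_epochs s = concat (map (\<lambda>j. case s ! j of None \<Rightarrow> []
     | Some x \<Rightarrow> [(x, count_list (take j s) (Some x))]) [0..<length s])"

lemma label_epochs_Nil [simp]: "label_epochs [] = []"
  by (simp add: label_epochs_def)

lemma label_epochs_snoc:
  "label_epochs (s @ [z]) = label_epochs s @
     (case z of None \<Rightarrow> [] | Some x \<Rightarrow> [(x, count_list s (Some x))])"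
proof -
  let ?g = "\<lambda>s j. case s ! j of None \<Rightarrow> [] | Some x \<Rightarrow> [(x, count_list (take j s) (Some x))]"
  have "map (?g (s @ [z])) [0..<length s] = map (?g s) [0..<length s]"
    by (intro map_cong) (auto simp: nth_append split: option.split)
  moreover have "?g (s @ [z]) (length s) =
      (case z of None \<Rightarrow> [] | Some x \<Rightarrow> [(x, count_list s (Some x))])"
    by (simp split: option.split)
  ultimately show ?thesis
    unfolding label_epochs_def length_append_singleton upt_Suc map_append concat_append
    by (simp only: if_True le0 map_append concat_append list.map concat.simps append_Nil2)
qed

lemma set_label_epochs: "(x, i) \<in> set (label_epochs s) \<Longrightarrow> Some x \<in> set s \<and> i < count_list s (Some x)"
proof (induction s rule: rev_induct)
  case (snoc z s)
  then show ?case by (auto simp: label_epochs_snoc split: option.splits if_splits)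
qed simp

text \<open>Distinct labels name distinct thresholds and destinations, so each update along the list
  uses fresh randomness.\<close>

lemma distinct_label_epochs: "distinct (label_epochs s)"
proof (induction s rule: rev_induct)
  case (snoc z s)
  have "(x, count_list s (Some x)) \<notin> set (label_epochs s)" for x
    using set_label_epochs by fastforce
  then show ?case using snoc by (simp add: label_epochs_snoc split: option.split)
qed simp

lemma initial_segment_lessThan:
  fixes A :: "nat set"
  assumes "finite A" "\<And>i j. j \<in> A \<Longrightarrow> i \<le> j \<Longrightarrow> i \<in> A"
  shows "A = {..<card A}"
proof (cases "A = {}")
  case False
  then have "A = {..Max A}" using assms(1) assms(2)[OF Max_in[OF assms(1)]] by (auto intro: Max_ge)
  then have "card A = Suc (Max A)" by (metis card_atMost)
  then show ?thesis using \<open>A = {..Max A}\<close> lessThan_Suc_atMost by simp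
qed simp

text \<open>The indices of the epochs of x up to a given time form an initial segment of the natural
  numbers. With numbering from 0, the epoch in a cell labelled x therefore has as its index the
  number of earlier cells labelled x, and concatenation over the cells respects time.\<close>

lemma in_temporal_order_label_epochs:
  fixes \<tau> :: "'x \<Rightarrow> nat \<Rightarrow> real"
  assumes mono: "\<And>x. strict_mono (\<tau> x)" and pos: "\<And>x. 0 < \<tau> x 0"
    and lim: "\<And>x. filterlim (\<tau> x) at_top sequentially" and h: "0 < h"
    and s: "set s \<subseteq> insert None (Some ` \<Lambda>)"
    and cells: "\<And>x j. x \<in> \<Lambda> \<Longrightarrow> j < length s \<Longrightarrow>
      card {i. \<tau> x i \<in> {real j * h<..real (Suc j) * h}} = (if s ! j = Some x then 1 else 0)"
  shows "in_temporal_order \<tau> (epochs_in \<Lambda> \<tau> 0 (real (length s) * h)) (label_epochs s)"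
proof -
  \<comment> \<open>\<open>card\<close> is 0 on infinite sets, so counts determine index sets only
    once the divergence of the epochs has given finiteness.\<close>
  have fin: "finite {i. \<tau> x i \<le> c}" for x c
  proof -
    have "eventually (\<lambda>i. c < \<tau> x i) sequentially"
      using lim filterlim_at_top_dense by blast
    then obtain k where "\<And>i. k \<le> i \<Longrightarrow> c < \<tau> x i"
      by (auto simp: eventually_sequentially)
    then have "{i. \<tau> x i \<le> c} \<subseteq> {..<k}" by (force simp: not_le[symmetric])
    then show ?thesis using finite_subset by blast
  qed
  have seg: "{i. \<tau> x i \<le> c} = {..<card {i. \<tau> x i \<le> c}}" for x c
  proof (rule initial_segment_lessThan[OF fin])
    fix i j assume "j \<in> {i. \<tau> x i \<le> c}" "i \<le> j"
    then show "i \<in> {i. \<tau> x i \<le> c}"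
      using strict_mono_mono[OF mono, of x] by (auto dest: monoD order_trans)
  qed
  have pos': "0 < \<tau> x i" for x i
    using pos[of x] strict_mono_mono[OF mono, of x] by (meson le0 less_le_trans monoD)
  \<comment> \<open>The second conjunct carries the index of the next epoch of each site through the
    induction.\<close>
  have "in_temporal_order \<tau> (epochs_in \<Lambda> \<tau> 0 (real (length s) * h)) (label_epochs s) \<and>
    (\<forall>x\<in>\<Lambda>. card {i. \<tau> x i \<le> real (length s) * h} = count_list s (Some x))"
    using s cells
  proof (induction s rule: rev_induct)
    case Nil
    then show ?case
      using pos' by (auto simp: in_temporal_order_def epochs_in_def not_le[symmetric])
  next
    case (snoc z s)
    let ?m = "length s"
    let ?c = "real ?m * h" and ?c' = "real (Suc ?m) * h"
    have cc': "?c \<le> ?c'" using h by simp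
    have IH: "in_temporal_order \<tau> (epochs_in \<Lambda> \<tau> 0 ?c) (label_epochs s)"
      "\<And>x. x \<in> \<Lambda> \<Longrightarrow> card {i. \<tau> x i \<le> ?c} = count_list s (Some x)"
    proof -
      have "card {i. \<tau> x i \<in> {real j * h<..real (Suc j) * h}} = (if s ! j = Some x then 1 else 0)"
        if "x \<in> \<Lambda>" "j < length s" for x j
        using snoc.prems(2)[OF that(1), of j] that(2) by (simp add: nth_append)
      then show "in_temporal_order \<tau> (epochs_in \<Lambda> \<tau> 0 ?c) (label_epochs s)"
        "\<And>x. x \<in> \<Lambda> \<Longrightarrow> card {i. \<tau> x i \<le> ?c} = count_list s (Some x)"
        using snoc.IH snoc.prems(1) by auto
    qed
    have last: "{i. \<tau> x i \<in> {?c<..?c'}} = (if z = Some x then {count_list s (Some x)} else {})"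
      if "x \<in> \<Lambda>" for x
    proof -
      have 1: "{i. \<tau> x i \<in> {?c<..?c'}} = {i. \<tau> x i \<le> ?c'} - {i. \<tau> x i \<le> ?c}" by auto
      have 2: "card {i. \<tau> x i \<in> {?c<..?c'}} = (if z = Some x then 1 else 0)"
        using snoc.prems(2)[OF that, of ?m] by simp
      have 3: "{i. \<tau> x i \<in> {?c<..?c'}} = {card {i. \<tau> x i \<le> ?c}..<card {i. \<tau> x i \<le> ?c'}}"
        unfolding 1 by (subst (1 2) seg) auto
      let ?b = "card {i. \<tau> x i \<le> ?c'}"
      have "?b - count_list s (Some x) = (if z = Some x then 1 else 0)"
        using 2 unfolding 3 IH(2)[OF that] by simp
      then have "z = Some x \<and> ?b = Suc (count_list s (Some x)) \<or> z \<noteq> Some x \<and> ?b \<le> count_list s (Some x)"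
        by (auto split: if_splits)
      then show ?thesis
        unfolding 3 IH(2)[OF that] by (elim disjE conjE) simp_all
    qed
    have eq: "epochs_in \<Lambda> \<tau> 0 ?c' = epochs_in \<Lambda> \<tau> 0 ?c \<union> epochs_in \<Lambda> \<tau> ?c ?c'"
    proof -
      have "0 \<le> ?c" using h by simp
      then show ?thesis using cc' unfolding epochs_in_def by fastforce
    qed
    have new: "in_temporal_order \<tau> (epochs_in \<Lambda> \<tau> ?c ?c')
        (case z of None \<Rightarrow> [] | Some x \<Rightarrow> [(x, count_list s (Some x))])"
    proof -
      have "epochs_in \<Lambda> \<tau> ?c ?c' = {(x, i). x \<in> \<Lambda> \<and> z = Some x \<and> i = count_list s (Some x)}"
      proof (rule set_eqI, clarify)
        fix x i
        have "\<tau> x i \<in> {?c<..?c'} \<longleftrightarrow> z = Some x \<and> i = count_list s (Some x)" if "x \<in> \<Lambda>"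
        proof -
          have "i \<in> {i. \<tau> x i \<in> {?c<..?c'}} \<longleftrightarrow> z = Some x \<and> i = count_list s (Some x)"
            unfolding last[OF that] by simp
          then show ?thesis by (simp only: mem_Collect_eq)
        qed
        then show "(x, i) \<in> epochs_in \<Lambda> \<tau> ?c ?c' \<longleftrightarrow>
            (x, i) \<in> {(x, i). x \<in> \<Lambda> \<and> z = Some x \<and> i = count_list s (Some x)}"
          unfolding epochs_in_def by blast
      qed
      then show ?thesis
        using snoc.prems(1) by (auto simp: in_temporal_order_def split: option.splits)
    qed
    have "in_temporal_order \<tau> (epochs_in \<Lambda> \<tau> 0 ?c') (label_epochs (s @ [z]))"
      unfolding eq label_epochs_snoc
      by (rule in_temporal_order_append[OF IH(1) new]) (auto simp: epochs_in_def)
    moreover have "card {i. \<tau> x i \<le> ?c'} = count_list (s @ [z]) (Some x)" if "x \<in> \<Lambda>" for x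
    proof -
      have "{i. \<tau> x i \<le> ?c'} = {i. \<tau> x i \<le> ?c} \<union> {i. \<tau> x i \<in> {?c<..?c'}}"
        using cc' by auto
      then have "card {i. \<tau> x i \<le> ?c'} = card {i. \<tau> x i \<le> ?c} + card {i. \<tau> x i \<in> {?c<..?c'}}"
        using fin[of x ?c] fin[of x ?c']
        by (subst card_Un_disjoint[symmetric]) (auto elim: rev_finite_subset)
      then show ?thesis unfolding last[OF that] IH(2)[OF that] by simp
    qed
    ultimately show ?case by simp
  qed
  then show ?thesis by blast
qed

section \<open>Invariance under an update at a random site\<close>

lemma pmf_replicate_pmf_Cons:
  "pmf (replicate_pmf (Suc n) q) (x # xs) = pmf q x * pmf (replicate_pmf n q) xs"
proof -
  have "replicate_pmf (Suc n) q = map_pmf (\<lambda>(x, xs). x # xs) (pair_pmf q (replicate_pmf n q))"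
    by (simp add: map_pmf_def pair_pmf_def bind_assoc_pmf bind_return_pmf)
  then show ?thesis
    using pmf_map_inj'[of "\<lambda>(x, xs). x # xs" "pair_pmf q (replicate_pmf n q)" "(x, xs)"]
    by (simp add: inj_on_def pmf_pair)
qed

lemma pmf_replicate_pmf: "pmf (replicate_pmf (length s) q) s = (\<Prod>j<length s. pmf q (s ! j))"
proof (induction s)
  case (Cons x xs)
  show ?case
    by (simp only: list.size add_0_right add_Suc_right pmf_replicate_pmf_Cons Cons.IH
        prod.lessThan_Suc_shift nth_Cons_0 nth_Cons_Suc)
qed simp

text \<open>\<open>marg_Suc\<close> says that the rate at which x releases a particle, weighted by
  the marginal, is \<phi> times the weight of the occupation number after the release. The constant
  \<phi> is the same for all x, which is how the disorder drops out. The bound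
  \<open>rate_le\<close> turns rates into probabilities after division by
  \<open>r_inf\<close>.\<close>

locale zrp_kernel =
  fixes r :: "nat \<Rightarrow> real" and \<alpha> :: "'x::ab_group_add \<Rightarrow> real" and r_inf \<phi> :: real
    and marg :: "'x \<Rightarrow> nat pmf" and p :: "'x pmf"
  assumes r_0: "r 0 = 0"
    and rate_nonneg: "0 \<le> \<alpha> x * r k" and rate_le: "\<alpha> x * r k \<le> r_inf"
    and r_inf_pos: "0 < r_inf" and \<phi>_nonneg: "0 \<le> \<phi>"
    and marg_Suc: "\<alpha> x * r (Suc k) * pmf (marg x) (Suc k) = \<phi> * pmf (marg x) k"
begin

definition jump_prob :: "'x \<Rightarrow> ('x \<Rightarrow> nat) \<Rightarrow> real" where
  "jump_prob x \<eta> = \<alpha> x * r (\<eta> x) / r_inf"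

text \<open>One epoch at x with its two marks averaged out: a threshold uniform on
  \<open>[0, r_inf]\<close> lies below the rate with probability \<open>jump_prob\<close>.\<close>

definition jump_kernel :: "'x set \<Rightarrow> 'x \<Rightarrow> ('x \<Rightarrow> nat) \<Rightarrow> ('x \<Rightarrow> nat) pmf" where
  "jump_kernel \<Lambda> x \<eta> = do {
     n \<leftarrow> p;
     b \<leftarrow> bernoulli_pmf (jump_prob x \<eta>);
     return_pmf (if b then move_particle x (box_shift \<Lambda> n x) \<eta> else \<eta>)}"

text \<open>The default value 0 off a finite \<Lambda> makes this a discrete law, so that discrete
  kernels apply although the space of all configurations is uncountable.\<close>

definition box_law :: "'x set \<Rightarrow> ('x \<Rightarrow> nat) pmf" where
  "box_law \<Lambda> = Pi_pmf \<Lambda> 0 marg"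

primrec site_kernel :: "'x set \<Rightarrow> 'x list \<Rightarrow> ('x \<Rightarrow> nat) \<Rightarrow> ('x \<Rightarrow> nat) pmf" where
  "site_kernel \<Lambda> [] \<eta> = return_pmf \<eta>"
| "site_kernel \<Lambda> (x # xs) \<eta> = jump_kernel \<Lambda> x \<eta> \<bind> site_kernel \<Lambda> xs"

text \<open>The content of a time cell given that it holds at most one epoch: \<beta> is the
  conditional probability of an epoch, whose site is uniform because all sites have the same Poisson
  rate.\<close>

definition cell_law :: "'x set \<Rightarrow> real \<Rightarrow> 'x option pmf" where
  "cell_law \<Lambda> \<beta> = bernoulli_pmf \<beta> \<bind>
     (\<lambda>b. if b then map_pmf Some (pmf_of_set \<Lambda>) else return_pmf None)"

section \<open>Balance of the particle flux under the box law\<close>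

lemma jump_prob_bounds: "0 \<le> jump_prob x \<eta>" "jump_prob x \<eta> \<le> 1"
  using rate_nonneg rate_le r_inf_pos by (auto simp: jump_prob_def)

text \<open>An index shift. The term at k = 0 carries the factor r 0 = 0, so the truncated value of
  \<open>k - 1\<close> there is harmless; on the remaining terms \<open>marg_Suc\<close>
  applies.\<close>

lemma nn_integral_rate_marg:
  fixes g :: "nat \<Rightarrow> ennreal"
  shows "(\<integral>\<^sup>+k. ennreal (\<alpha> x * r k) * g (k - 1) \<partial>marg x) = ennreal \<phi> * (\<integral>\<^sup>+k. g k \<partial>marg x)"
proof -
  have "(\<integral>\<^sup>+k. ennreal (\<alpha> x * r k) * g (k - 1) \<partial>marg x) =
      (\<Sum>k. ennreal (pmf (marg x) k) * (ennreal (\<alpha> x * r k) * g (k - 1)))"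
    by (simp add: nn_integral_measure_pmf nn_integral_count_space_nat)
  also have "\<dots> = (\<Sum>k. ennreal (pmf (marg x) (Suc k)) * (ennreal (\<alpha> x * r (Suc k)) * g k))"
    by (subst suminf_offset[where i = 1]) (simp_all add: r_0)
  also have "\<dots> = (\<Sum>k. ennreal \<phi> * (ennreal (pmf (marg x) k) * g k))"
  proof (rule suminf_cong)
    fix k
    have "ennreal (pmf (marg x) (Suc k)) * ennreal (\<alpha> x * r (Suc k)) = ennreal \<phi> * ennreal (pmf (marg x) k)"
      using marg_Suc[of x k] rate_nonneg \<phi>_nonneg by (simp add: ennreal_mult[symmetric] mult.commute)
    then show "ennreal (pmf (marg x) (Suc k)) * (ennreal (\<alpha> x * r (Suc k)) * g k) =
        ennreal \<phi> * (ennreal (pmf (marg x) k) * g k)"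
      by (simp add: mult.assoc[symmetric])
  qed
  also have "\<dots> = ennreal \<phi> * (\<integral>\<^sup>+k. g k \<partial>marg x)"
    by (simp add: nn_integral_measure_pmf nn_integral_count_space_nat)
  finally show ?thesis .
qed

lemma nn_integral_rate_box_law:
  fixes f :: "('x \<Rightarrow> nat) \<Rightarrow> ennreal"
  assumes "finite \<Lambda>" "x \<in> \<Lambda>"
  shows "(\<integral>\<^sup>+\<eta>. ennreal (\<alpha> x * r (\<eta> x)) * f (\<eta>(x := \<eta> x - 1)) \<partial>box_law \<Lambda>) =
    ennreal \<phi> * (\<integral>\<^sup>+\<eta>. f \<eta> \<partial>box_law \<Lambda>)"
proof -
  have "\<Lambda> = insert x (\<Lambda> - {x})" using assms by auto
  then have "box_law \<Lambda> = Pi_pmf (insert x (\<Lambda> - {x})) 0 marg"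
    by (simp add: box_law_def)
  also have "\<dots> = do {\<zeta> \<leftarrow> Pi_pmf (\<Lambda> - {x}) 0 marg; k \<leftarrow> marg x; return_pmf (\<zeta>(x := k))}"
    using assms by (subst Pi_pmf_insert') (auto intro: bind_commute_pmf)
  finally have *: "box_law \<Lambda> = do {\<zeta> \<leftarrow> Pi_pmf (\<Lambda> - {x}) 0 marg; k \<leftarrow> marg x; return_pmf (\<zeta>(x := k))}" .
  have "(\<integral>\<^sup>+k. ennreal (\<alpha> x * r k) * f (\<zeta>(x := k - 1)) \<partial>marg x) =
      ennreal \<phi> * (\<integral>\<^sup>+k. f (\<zeta>(x := k)) \<partial>marg x)" for \<zeta>
    by (rule nn_integral_rate_marg)
  then show ?thesis
    unfolding * by (simp add: nn_integral_cmult)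
qed

text \<open>Both sides equal \<open>\<phi>\<close> times the integral of \<open>f\<close> with one particle added at \<open>y\<close>.\<close>

lemma nn_integral_move_particle:
  fixes f :: "('x \<Rightarrow> nat) \<Rightarrow> ennreal"
  assumes "finite \<Lambda>" "x \<in> \<Lambda>" "y \<in> \<Lambda>"
  shows "(\<integral>\<^sup>+\<eta>. ennreal (jump_prob x \<eta>) * f (move_particle x y \<eta>) \<partial>box_law \<Lambda>) =
    (\<integral>\<^sup>+\<eta>. ennreal (jump_prob y \<eta>) * f \<eta> \<partial>box_law \<Lambda>)"
proof -
  define add where "add \<eta> = \<eta>(y := \<eta> y + 1)" for \<eta> :: "'x \<Rightarrow> nat"
  have rate: "ennreal (jump_prob z \<eta>) = ennreal (\<alpha> z * r (\<eta> z)) * ennreal (1 / r_inf)" for z \<eta>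
    using rate_nonneg r_inf_pos by (simp add: jump_prob_def ennreal_mult[symmetric])
  \<comment> \<open>An empty site has rate 0, so the two configurations have to agree only when
    \<eta> x is positive.\<close>
  have eq: "ennreal (\<alpha> x * r (\<eta> x)) * f (move_particle x y \<eta>) =
      ennreal (\<alpha> x * r (\<eta> x)) * f (add (\<eta>(x := \<eta> x - 1)))" for x \<eta>
  proof (cases "\<eta> x = 0")
    case False
    then have "move_particle x y \<eta> = add (\<eta>(x := \<eta> x - 1))"
      by (auto simp: move_particle_def add_def fun_eq_iff)
    then show ?thesis by simp
  qed (simp add: r_0)
  have *: "(\<integral>\<^sup>+\<eta>. ennreal (\<alpha> z * r (\<eta> z)) * f (move_particle z y \<eta>) \<partial>box_law \<Lambda>) =
      ennreal \<phi> * (\<integral>\<^sup>+\<eta>. f (add \<eta>) \<partial>box_law \<Lambda>)" if "z \<in> \<Lambda>" for z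
    unfolding eq by (rule nn_integral_rate_box_law[OF assms(1) that])
  \<comment> \<open>\<open>move_particle\<close> adds before it subtracts, so this holds at an empty
    site too.\<close>
  have id: "move_particle y y \<eta> = \<eta>" for \<eta>
    by (auto simp: move_particle_def fun_eq_iff)
  have "(\<integral>\<^sup>+\<eta>. ennreal (\<alpha> x * r (\<eta> x)) * f (move_particle x y \<eta>) \<partial>box_law \<Lambda>) =
      (\<integral>\<^sup>+\<eta>. ennreal (\<alpha> y * r (\<eta> y)) * f \<eta> \<partial>box_law \<Lambda>)"
    using *[OF assms(2)] *[OF assms(3)] by (simp add: id)
  moreover have "(\<integral>\<^sup>+\<eta>. ennreal (jump_prob z \<eta>) * g \<eta> \<partial>box_law \<Lambda>) =
      ennreal (1 / r_inf) * (\<integral>\<^sup>+\<eta>. ennreal (\<alpha> z * r (\<eta> z)) * g \<eta> \<partial>box_law \<Lambda>)" for z g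
    unfolding rate by (subst nn_integral_cmult[symmetric]) (simp_all add: mult_ac)
  ultimately show ?thesis by simp
qed

text \<open>With the displacement fixed first, the destination is a permutation \<sigma> of
  \<Lambda>. By \<open>nn_integral_move_particle\<close> the mass that jumps from x to \<sigma> x
  and reaches \<xi> equals the mass of \<xi> weighted by the jump probability at \<sigma> x; summed
  over x, arrivals at \<xi> replace departures from \<xi>.\<close>

lemma box_law_jump_invariant:
  assumes "finite \<Lambda>" "\<Lambda> \<noteq> {}"
  shows "do {\<eta> \<leftarrow> box_law \<Lambda>; x \<leftarrow> pmf_of_set \<Lambda>; jump_kernel \<Lambda> x \<eta>} = box_law \<Lambda>"
proof -
  have fixed: "do {\<eta> \<leftarrow> box_law \<Lambda>; x \<leftarrow> pmf_of_set \<Lambda>; b \<leftarrow> bernoulli_pmf (jump_prob x \<eta>);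
      return_pmf (if b then move_particle x (\<sigma> x) \<eta> else \<eta>)} = box_law \<Lambda>" (is "?A = _")
    if \<sigma>: "bij_betw \<sigma> \<Lambda> \<Lambda>" for \<sigma>
  proof (rule pmf_eqI)
    fix \<xi>
    let ?F = "\<lambda>\<eta>. ennreal (indicator {\<xi>} (\<eta> :: 'x \<Rightarrow> nat))"
    have pt: "ennreal (pmf (return_pmf \<eta>) \<xi>) = ?F \<eta>" for \<eta>
      by (simp add: indicator_def)
    have sum1: "?F \<eta> * ennreal (jump_prob x \<eta>) + ?F \<eta> * ennreal (1 - jump_prob x \<eta>) = ?F \<eta>" for x \<eta>
      using jump_prob_bounds[of x \<eta>]
      by (simp add: distrib_left[symmetric] flip: ennreal_plus)
    have "ennreal (pmf ?A \<xi>) = (\<integral>\<^sup>+\<eta>. (\<Sum>x\<in>\<Lambda>. ennreal (jump_prob x \<eta>) * ?F (move_particle x (\<sigma> x) \<eta>) +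
        ?F \<eta> * ennreal (1 - jump_prob x \<eta>)) / card \<Lambda> \<partial>box_law \<Lambda>)"
      using assms jump_prob_bounds
      by (simp add: ennreal_pmf_bind nn_integral_pmf_of_set pt mult.commute del: ennreal_indicator)
    also have "\<dots> = (\<Sum>x\<in>\<Lambda>. (\<integral>\<^sup>+\<eta>. ennreal (jump_prob x \<eta>) * ?F (move_particle x (\<sigma> x) \<eta>) \<partial>box_law \<Lambda>) +
        (\<integral>\<^sup>+\<eta>. ?F \<eta> * ennreal (1 - jump_prob x \<eta>) \<partial>box_law \<Lambda>)) / card \<Lambda>"
      by (simp add: nn_integral_divide nn_integral_sum nn_integral_add del: ennreal_indicator)
    also have "(\<Sum>x\<in>\<Lambda>. (\<integral>\<^sup>+\<eta>. ennreal (jump_prob x \<eta>) * ?F (move_particle x (\<sigma> x) \<eta>) \<partial>box_law \<Lambda>) +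
        (\<integral>\<^sup>+\<eta>. ?F \<eta> * ennreal (1 - jump_prob x \<eta>) \<partial>box_law \<Lambda>)) =
        (\<Sum>x\<in>\<Lambda>. (\<integral>\<^sup>+\<eta>. ennreal (jump_prob (\<sigma> x) \<eta>) * ?F \<eta> \<partial>box_law \<Lambda>)) +
        (\<Sum>x\<in>\<Lambda>. (\<integral>\<^sup>+\<eta>. ?F \<eta> * ennreal (1 - jump_prob x \<eta>) \<partial>box_law \<Lambda>))"
      unfolding sum.distrib[symmetric]
    proof (rule sum.cong[OF refl])
      fix x assume x: "x \<in> \<Lambda>"
      then have "\<sigma> x \<in> \<Lambda>" using \<sigma> by (auto simp: bij_betw_def)
      from nn_integral_move_particle[OF assms(1) x this, of ?F]
      show "(\<integral>\<^sup>+\<eta>. ennreal (jump_prob x \<eta>) * ?F (move_particle x (\<sigma> x) \<eta>) \<partial>box_law \<Lambda>) +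
          (\<integral>\<^sup>+\<eta>. ?F \<eta> * ennreal (1 - jump_prob x \<eta>) \<partial>box_law \<Lambda>) =
          (\<integral>\<^sup>+\<eta>. ennreal (jump_prob (\<sigma> x) \<eta>) * ?F \<eta> \<partial>box_law \<Lambda>) +
          (\<integral>\<^sup>+\<eta>. ?F \<eta> * ennreal (1 - jump_prob x \<eta>) \<partial>box_law \<Lambda>)"
        by simp
    qed
    \<comment> \<open>Bijectivity enters here: the sites \<sigma> x run through \<Lambda> exactly
      once.\<close>
    also have "(\<Sum>x\<in>\<Lambda>. (\<integral>\<^sup>+\<eta>. ennreal (jump_prob (\<sigma> x) \<eta>) * ?F \<eta> \<partial>box_law \<Lambda>)) =
        (\<Sum>x\<in>\<Lambda>. (\<integral>\<^sup>+\<eta>. ?F \<eta> * ennreal (jump_prob x \<eta>) \<partial>box_law \<Lambda>))"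
      by (subst sum.reindex_bij_betw[OF \<sigma>, of "\<lambda>x. (\<integral>\<^sup>+\<eta>. ennreal (jump_prob x \<eta>) * ?F \<eta> \<partial>box_law \<Lambda>)"])
        (simp add: mult.commute)
    also have "\<dots> + (\<Sum>x\<in>\<Lambda>. (\<integral>\<^sup>+\<eta>. ?F \<eta> * ennreal (1 - jump_prob x \<eta>) \<partial>box_law \<Lambda>)) =
        (\<Sum>x\<in>\<Lambda>. \<integral>\<^sup>+\<eta>. ?F \<eta> \<partial>box_law \<Lambda>)"
      unfolding sum.distrib[symmetric]
      by (subst nn_integral_add[symmetric]) (simp_all add: sum1 del: ennreal_indicator)
    also have "\<dots> / card \<Lambda> = (\<integral>\<^sup>+\<eta>. ?F \<eta> \<partial>box_law \<Lambda>)"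
      using assms ennreal_mult_divide_eq[of "of_nat (card \<Lambda>)" "\<integral>\<^sup>+\<eta>. ?F \<eta> \<partial>box_law \<Lambda>"]
      by (simp add: mult.commute del: ennreal_indicator)
    also have "\<dots> = ennreal (pmf (box_law \<Lambda>) \<xi>)"
      by (simp add: ennreal_indicator emeasure_pmf_single)
    finally show "pmf ?A \<xi> = pmf (box_law \<Lambda>) \<xi>" by simp
  qed
  \<comment> \<open>The displacement has the same law p at every site, so it may be drawn before the
    configuration and the site.\<close>
  have "do {\<eta> \<leftarrow> box_law \<Lambda>; x \<leftarrow> pmf_of_set \<Lambda>; jump_kernel \<Lambda> x \<eta>} =
      do {n \<leftarrow> p; \<eta> \<leftarrow> box_law \<Lambda>; x \<leftarrow> pmf_of_set \<Lambda>; b \<leftarrow> bernoulli_pmf (jump_prob x \<eta>);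
        return_pmf (if b then move_particle x (box_shift \<Lambda> n x) \<eta> else \<eta>)}"
    unfolding jump_kernel_def
    by (subst (2) bind_commute_pmf, subst (1) bind_commute_pmf) (rule refl)
  also have "\<dots> = do {n \<leftarrow> p; box_law \<Lambda>}"
    by (subst fixed[OF bij_betw_box_shift[OF assms(1)]]) (rule refl)
  finally show ?thesis by simp
qed

lemma box_law_cell_invariant:
  assumes "finite \<Lambda>" "\<Lambda> \<noteq> {}"
  shows "do {z \<leftarrow> cell_law \<Lambda> \<beta>; \<eta> \<leftarrow> box_law \<Lambda>;
      case z of None \<Rightarrow> return_pmf \<eta> | Some x \<Rightarrow> jump_kernel \<Lambda> x \<eta>} = box_law \<Lambda>"
proof -
  have "do {z \<leftarrow> (if b then map_pmf Some (pmf_of_set \<Lambda>) else return_pmf None); \<eta> \<leftarrow> box_law \<Lambda>;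
      case z of None \<Rightarrow> return_pmf \<eta> | Some x \<Rightarrow> jump_kernel \<Lambda> x \<eta>} = box_law \<Lambda>" for b
  proof (cases b)
    case True
    have "do {x \<leftarrow> pmf_of_set \<Lambda>; \<eta> \<leftarrow> box_law \<Lambda>; jump_kernel \<Lambda> x \<eta>} = box_law \<Lambda>"
      using box_law_jump_invariant[OF assms] by (subst bind_commute_pmf)
    then show ?thesis using True by (simp add: bind_map_pmf)
  qed (simp add: bind_return_pmf bind_return_pmf')
  then show ?thesis by (simp add: cell_law_def bind_assoc_pmf)
qed

text \<open>The average over the record matters: in general an update at one prescribed site removes
  particles without compensation. As the entries are independent, the average over the first entry
  can be taken before the later updates are applied.\<close>

lemma box_law_cells_invariant:
  assumes "finite \<Lambda>" "\<Lambda> \<noteq> {}"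
  shows "do {s \<leftarrow> replicate_pmf m (cell_law \<Lambda> \<beta>); \<eta> \<leftarrow> box_law \<Lambda>;
      site_kernel \<Lambda> (map the (filter (\<lambda>z. z \<noteq> None) s)) \<eta>} = box_law \<Lambda>"
proof (induction m)
  case 0
  have "site_kernel \<Lambda> [] = return_pmf" by (simp add: fun_eq_iff)
  then show ?case by (simp add: bind_return_pmf bind_return_pmf' del: site_kernel.simps)
next
  case (Suc m)
  let ?sites = "\<lambda>s. map the (filter (\<lambda>z. z \<noteq> None) s)"
  let ?R = "replicate_pmf m (cell_law \<Lambda> \<beta>)"
  let ?K = "\<lambda>z \<eta>. case z of None \<Rightarrow> return_pmf \<eta> | Some x \<Rightarrow> jump_kernel \<Lambda> x \<eta>"
  have K: "site_kernel \<Lambda> (?sites (z # s)) = (\<lambda>\<eta>. ?K z \<eta> \<bind> site_kernel \<Lambda> (?sites s))" for z s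
    by (rule ext, cases z) (simp_all add: bind_return_pmf)
  have "do {s \<leftarrow> replicate_pmf (Suc m) (cell_law \<Lambda> \<beta>); \<eta> \<leftarrow> box_law \<Lambda>; site_kernel \<Lambda> (?sites s) \<eta>} =
      do {z \<leftarrow> cell_law \<Lambda> \<beta>; s \<leftarrow> ?R; \<eta> \<leftarrow> box_law \<Lambda>; ?K z \<eta> \<bind> site_kernel \<Lambda> (?sites s)}"
    by (simp only: replicate_pmf.simps bind_assoc_pmf bind_return_pmf K)
  also have "\<dots> = do {s \<leftarrow> ?R; \<eta> \<leftarrow> do {z \<leftarrow> cell_law \<Lambda> \<beta>; \<eta> \<leftarrow> box_law \<Lambda>; ?K z \<eta>};
      site_kernel \<Lambda> (?sites s) \<eta>}"
    by (subst bind_commute_pmf) (simp only: bind_assoc_pmf)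
  finally show ?case
    unfolding box_law_cell_invariant[OF assms] Suc.IH .
qed

lemma pmf_cell_law:
  assumes "finite \<Lambda>" "\<Lambda> \<noteq> {}" "0 \<le> \<beta>" "\<beta> \<le> 1"
  shows "pmf (cell_law \<Lambda> \<beta>) None = 1 - \<beta>"
    and "x \<in> \<Lambda> \<Longrightarrow> pmf (cell_law \<Lambda> \<beta>) (Some x) = \<beta> / card \<Lambda>"
  using assms pmf_map_inj'[of Some "pmf_of_set \<Lambda>" x]
  by (auto simp: cell_law_def pmf_bind pmf_eq_0_set_pmf)

lemma set_pmf_cell_law:
  assumes "finite \<Lambda>" "\<Lambda> \<noteq> {}"
  shows "set_pmf (cell_law \<Lambda> \<beta>) \<subseteq> insert None (Some ` \<Lambda>)"
  using set_pmf_of_set[OF assms(2,1)] by (auto simp: cell_law_def split: if_splits)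

end

section \<open>Measurability of the graphical construction\<close>

lemma measurable_config_spaceI:
  assumes "\<And>x. (\<lambda>\<omega>. f \<omega> x) \<in> measurable N (count_space UNIV)"
  shows "f \<in> measurable N config_space"
  unfolding config_space_def using assms by (intro measurable_PiM_single') auto

lemma measurable_config_spaceD [measurable_dest]:
  assumes "f \<in> measurable N config_space"
  shows "(\<lambda>\<omega>. f \<omega> x) \<in> measurable N (count_space UNIV)"
  using measurable_compose[OF assms[unfolded config_space_def] measurable_component_singleton[of x]]
  by simp

lemma pred_config_eq:
  fixes \<xi> :: "('d::finite) config"
  assumes [measurable]: "f \<in> measurable N config_space"
  shows "Measurable.pred N (\<lambda>\<omega>. f \<omega> = \<xi>)"
  unfolding fun_eq_iff by measurable

lemma measurable_epoch_update:
  fixes \<eta> :: "'w \<Rightarrow> ('d::finite) config"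
  assumes [measurable]: "\<eta> \<in> measurable N config_space" "u x i \<in> borel_measurable N"
    "dst x i \<in> measurable N (count_space UNIV)"
  shows "(\<lambda>\<omega>. epoch_update r \<alpha> (\<lambda>x i. u x i \<omega>) (\<lambda>x i. dst x i \<omega>) (x, i) (\<eta> \<omega>))
    \<in> measurable N config_space"
proof (rule measurable_config_spaceI)
  fix z
  have [measurable]: "r \<in> borel_measurable (count_space UNIV)" by simp
  have "(\<lambda>\<omega>. if u x i \<omega> < \<alpha> x * r (\<eta> \<omega> x)
      then \<eta> \<omega> z + (if z = dst x i \<omega> then 1 else 0) - (if z = x then 1 else 0) else \<eta> \<omega> z)
    \<in> measurable N (count_space UNIV)"
    by measurable
  then show "(\<lambda>\<omega>. epoch_update r \<alpha> (\<lambda>x i. u x i \<omega>) (\<lambda>x i. dst x i \<omega>) (x, i) (\<eta> \<omega>) z)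
      \<in> measurable N (count_space UNIV)"
    by (rule back_subst[where P = "\<lambda>f. f \<in> _"]) (auto simp: epoch_update_def move_particle_def)
qed

lemma measurable_fold_epoch_update:
  fixes \<eta> :: "'w \<Rightarrow> ('d::finite) config"
  assumes "\<eta> \<in> measurable N config_space" "\<And>x i. u x i \<in> borel_measurable N"
    "\<And>x i. dst x i \<in> measurable N (count_space UNIV)"
  shows "(\<lambda>\<omega>. fold (epoch_update r \<alpha> (\<lambda>x i. u x i \<omega>) (\<lambda>x i. dst x i \<omega>)) es (\<eta> \<omega>))
    \<in> measurable N config_space"
  using assms(1)
proof (induction es arbitrary: \<eta>)
  case (Cons e es)
  obtain x i where e: "e = (x, i)" by (cases e)
  from measurable_epoch_update[OF Cons.prems assms(2,3), where r = r and \<alpha> = \<alpha> and x = x and i = i]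
  show ?case by (auto simp: e intro: Cons.IH)
qed simp

lemma pred_in_temporal_order:
  fixes \<tau> :: "'x::countable \<Rightarrow> nat \<Rightarrow> 'w \<Rightarrow> real"
  assumes [measurable]: "\<And>x i. \<tau> x i \<in> borel_measurable N" "\<And>e. Measurable.pred N (\<lambda>\<omega>. e \<in> E \<omega>)"
  shows "Measurable.pred N (\<lambda>\<omega>. in_temporal_order (\<lambda>x i. \<tau> x i \<omega>) (E \<omega>) es)"
  unfolding in_temporal_order_def set_eq_iff sorted_wrt_iff_nth_less case_prod_beta by measurable

text \<open>The ordered list is a random variable with countably many values, \<open>None\<close>
  standing for the default case, and for each fixed value the result is a composition of finitely
  many measurable updates.\<close>

lemma measurable_run_epochs:
  fixes \<eta> :: "'w \<Rightarrow> ('d::finite) config"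
  assumes \<tau>: "\<And>x i. \<tau> x i \<in> borel_measurable N" and E: "\<And>e. Measurable.pred N (\<lambda>\<omega>. e \<in> E \<omega>)"
    and \<eta>: "\<eta> \<in> measurable N config_space" and u: "\<And>x i. u x i \<in> borel_measurable N"
    and dst: "\<And>x i. dst x i \<in> measurable N (count_space UNIV)"
  shows "(\<lambda>\<omega>. run_epochs r \<alpha> (\<lambda>x i. \<tau> x i \<omega>) (\<lambda>x i. u x i \<omega>) (\<lambda>x i. dst x i \<omega>) (E \<omega>) (\<eta> \<omega>))
    \<in> measurable N config_space"
proof -
  define ord where "ord \<omega> = in_temporal_order (\<lambda>x i. \<tau> x i \<omega>) (E \<omega>)" for \<omega>
  have [measurable]: "Measurable.pred N (\<lambda>\<omega>. ord \<omega> es)" for es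
    unfolding ord_def by (rule pred_in_temporal_order[OF \<tau> E])
  define L where "L \<omega> = (if \<exists>es. ord \<omega> es then Some (THE es. ord \<omega> es) else None)" for \<omega>
  have L_Some: "L \<omega> = Some es \<longleftrightarrow> ord \<omega> es" for \<omega> es
  proof
    assume "L \<omega> = Some es"
    then obtain es' where "ord \<omega> es'" "es = (THE es. ord \<omega> es)"
      by (auto simp: L_def split: if_splits)
    moreover have "(THE es. ord \<omega> es) = es'"
      using calculation(1) in_temporal_order_unique unfolding ord_def by blast
    ultimately show "ord \<omega> es" by simp
  next
    assume es: "ord \<omega> es"
    then have "(THE es. ord \<omega> es) = es"
      using in_temporal_order_unique unfolding ord_def by blast
    then show "L \<omega> = Some es" using es by (auto simp: L_def)
  qed
  have L_None: "L \<omega> = None \<longleftrightarrow> (\<forall>es. \<not> ord \<omega> es)" for \<omega>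
    by (auto simp: L_def)
  have "Measurable.pred N (\<lambda>\<omega>. L \<omega> = l)" for l
    by (cases l) (simp_all add: L_Some L_None)
  then have L: "L \<in> measurable N (count_space UNIV)"
    unfolding pred_def
    by (auto simp: measurable_count_space_eq2_countable vimage_def Int_def conj_commute)
  define f where "f l \<omega> = (case l of None \<Rightarrow> \<eta> \<omega>
    | Some es \<Rightarrow> fold (epoch_update r \<alpha> (\<lambda>x i. u x i \<omega>) (\<lambda>x i. dst x i \<omega>)) es (\<eta> \<omega>))" for l \<omega>
  have "f l \<in> measurable N config_space" for l
    using \<eta> measurable_fold_epoch_update[OF \<eta> u dst, of r \<alpha>] by (cases l) (simp_all add: f_def[abs_def])
  then have "(\<lambda>\<omega>. f (L \<omega>) \<omega>) \<in> measurable N config_space"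
    by (rule measurable_compose_countable[OF _ L])
  moreover have "f (L \<omega>) \<omega> =
      run_epochs r \<alpha> (\<lambda>x i. \<tau> x i \<omega>) (\<lambda>x i. u x i \<omega>) (\<lambda>x i. dst x i \<omega>) (E \<omega>) (\<eta> \<omega>)" for \<omega>
    by (auto simp: f_def L_def run_epochs_def ord_def)
  ultimately show ?thesis by simp
qed

text \<open>Reachability is a countable union over path lengths, and each step a countable union
  over intermediate sites.\<close>

lemma pred_component:
  fixes J :: "'w \<Rightarrow> ('d::finite) site \<Rightarrow> 'd site \<Rightarrow> bool"
  assumes [measurable]: "\<And>x y. Measurable.pred N (\<lambda>\<omega>. J \<omega> x y)"
  shows "Measurable.pred N (\<lambda>\<omega>. (J \<omega>)\<^sup>*\<^sup>* x y)"
proof -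
  have "Measurable.pred N (\<lambda>\<omega>. (J \<omega> ^^ n) x y)" for n
    by (induction n arbitrary: y) (simp_all add: relcompp.simps OO_def, measurable)
  then show ?thesis
    unfolding rtranclp_is_Sup_relpowp by (simp add: Sup_fun_def)
qed

lemma pred_joined:
  fixes \<tau> :: "('d::finite) site \<Rightarrow> nat \<Rightarrow> 'w \<Rightarrow> real"
  assumes [measurable]: "\<And>x i. \<tau> x i \<in> borel_measurable N"
  shows "Measurable.pred N (\<lambda>\<omega>. joined \<N> (\<lambda>x i. \<tau> x i \<omega>) a b x y)"
  unfolding joined_def by measurable

lemma measurable_zrp_step:
  fixes \<eta> :: "'w \<Rightarrow> ('d::finite) config"
  assumes \<tau> [measurable]: "\<And>x i. \<tau> x i \<in> borel_measurable N"
    and \<eta>: "\<eta> \<in> measurable N config_space" and u: "\<And>x i. u x i \<in> borel_measurable N"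
    and dst: "\<And>x i. dst x i \<in> measurable N (count_space UNIV)"
  shows "(\<lambda>\<omega>. zrp_step \<N> r \<alpha> (\<lambda>x i. \<tau> x i \<omega>) (\<lambda>x i. u x i \<omega>) (\<lambda>x i. dst x i \<omega>) a b t (\<eta> \<omega>))
    \<in> measurable N config_space"
proof (rule measurable_config_spaceI)
  fix x
  have [measurable]: "Measurable.pred N (\<lambda>\<omega>. y \<in> component \<N> (\<lambda>x i. \<tau> x i \<omega>) a b x)" for y
    unfolding component_def mem_Collect_eq by (intro pred_component pred_joined \<tau>)
  have "Measurable.pred N (\<lambda>\<omega>. e \<in> {(y, i). y \<in> component \<N> (\<lambda>x i. \<tau> x i \<omega>) a b x \<and> \<tau> y i \<omega> \<in> {a<..t}})" for e
    by (cases e) simp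
  then have "(\<lambda>\<omega>. run_epochs r \<alpha> (\<lambda>x i. \<tau> x i \<omega>) (\<lambda>x i. u x i \<omega>) (\<lambda>x i. dst x i \<omega>)
      {(y, i). y \<in> component \<N> (\<lambda>x i. \<tau> x i \<omega>) a b x \<and> \<tau> y i \<omega> \<in> {a<..t}} (\<eta> \<omega>))
      \<in> measurable N config_space"
    by (rule measurable_run_epochs[OF \<tau> _ \<eta> u dst])
  from measurable_config_spaceD[OF this, of x]
  show "(\<lambda>\<omega>. zrp_step \<N> r \<alpha> (\<lambda>x i. \<tau> x i \<omega>) (\<lambda>x i. u x i \<omega>) (\<lambda>x i. dst x i \<omega>) a b t (\<eta> \<omega>) x)
    \<in> measurable N (count_space UNIV)"
    by (simp add: zrp_step_eq_run_epochs)
qed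

lemma measurable_zrp:
  fixes \<eta> :: "'w \<Rightarrow> ('d::finite) config"
  assumes \<tau>: "\<And>x i. \<tau> x i \<in> borel_measurable N"
    and \<eta>: "\<eta> \<in> measurable N config_space" and u: "\<And>x i. u x i \<in> borel_measurable N"
    and dst: "\<And>x i. dst x i \<in> measurable N (count_space UNIV)"
  shows "(\<lambda>\<omega>. zrp t0 \<N> r \<alpha> (\<lambda>x i. \<tau> x i \<omega>) (\<lambda>x i. u x i \<omega>) (\<lambda>x i. dst x i \<omega>) (\<eta> \<omega>) t)
    \<in> measurable N config_space"
proof -
  have "(\<lambda>\<omega>. zrp_grid t0 \<N> r \<alpha> (\<lambda>x i. \<tau> x i \<omega>) (\<lambda>x i. u x i \<omega>) (\<lambda>x i. dst x i \<omega>) (\<eta> \<omega>) k)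
      \<in> measurable N config_space" for k
    by (induction k) (simp_all only: zrp_grid.simps \<eta> measurable_zrp_step[OF \<tau> _ u dst])
  then show ?thesis
    unfolding zrp_def Let_def by (rule measurable_zrp_step[OF \<tau> _ u dst])
qed

lemma emeasure_eq_nn_integral_fibres:
  assumes "A \<in> sets N" "V \<in> space N \<rightarrow> C" "countable C"
    and "\<And>v. v \<in> C \<Longrightarrow> {\<omega> \<in> space N. V \<omega> = v} \<in> sets N"
  shows "emeasure N A = (\<integral>\<^sup>+v. emeasure N (A \<inter> {\<omega> \<in> space N. V \<omega> = v}) \<partial>count_space C)"
proof -
  have "A = (\<Union>v\<in>C. A \<inter> {\<omega> \<in> space N. V \<omega> = v})"
    using assms(2) sets.sets_into_space[OF assms(1)] by auto
  then have "emeasure N A = emeasure N (\<Union>v\<in>C. A \<inter> {\<omega> \<in> space N. V \<omega> = v})" by simp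
  also have "\<dots> = (\<integral>\<^sup>+v. emeasure N (A \<inter> {\<omega> \<in> space N. V \<omega> = v}) \<partial>count_space C)"
    using assms by (intro emeasure_UN_countable) (auto simp: disjoint_family_on_def)
  finally show ?thesis .
qed

section \<open>The driving randomness\<close>

lemma sets_vimage_algebra_subset: "sets (vimage_algebra X f A) \<subseteq> Pow X"
  using sets.space_closed[of "vimage_algebra X f A"] by simp

locale zrp_setup = prob_space M
  for M :: "'w measure" +
  fixes c r_inf \<phi> t0 :: real
    and p :: "(int ^ 'd::finite) pmf"
    and \<N> :: "(int ^ 'd) set"
    and r :: "nat \<Rightarrow> real"
    and \<alpha> :: "int ^ 'd \<Rightarrow> real"
    and \<eta>0 :: "'w \<Rightarrow> (int ^ 'd \<Rightarrow> nat)"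
    and T U :: "int ^ 'd \<Rightarrow> nat \<Rightarrow> 'w \<Rightarrow> real"
    and Y :: "int ^ 'd \<Rightarrow> nat \<Rightarrow> 'w \<Rightarrow> int ^ 'd"
  assumes c_pos: "0 < c"
    and finite_range: "finite \<N>" "set_pmf p \<subseteq> \<N>"
    and r_zero: "r 0 = 0" and r_one: "0 < r 1" and r_Suc: "\<And>k. 1 \<le> k \<Longrightarrow> r k \<le> r (Suc k)"
    and r_lim: "r \<longlonglongrightarrow> r_inf"
    and \<alpha>_bounds: "\<And>x. \<alpha> x \<in> {c..1}"
    and \<phi>_bounds: "\<phi> \<in> {0..<r_inf * c}"
    and randomness: "zrp_randomness M r_inf p \<eta>0 T U Y"
    and t0_pos: "0 < t0"
    and finite_components: "AE \<omega> in M. \<forall>x. finite (component \<N> (\<lambda>x i. T x i \<omega>) 0 t0 x)"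
    and initial_law: "distr M config_space \<eta>0 = zrp_product_measure r \<alpha> \<phi>"
begin

section \<open>Rates, partition function and marginals\<close>

lemma incseq_r: "incseq r"
proof (rule incseq_SucI)
  show "r n \<le> r (Suc n)" for n
    using r_zero r_one r_Suc by (cases n) auto
qed

lemma r_Suc_pos: "0 < r (Suc k)"
  using r_one monoD[OF incseq_r, of 1 "Suc k"] by simp

lemma r_nonneg: "0 \<le> r k"
  using r_zero monoD[OF incseq_r, of 0 k] by simp

lemma r_le: "r k \<le> r_inf"
  by (rule incseq_le[OF incseq_r r_lim])

lemma r_inf_positive: "0 < r_inf"
  using r_one r_le[of 1] by simp

lemma \<alpha>_pos: "0 < \<alpha> x" and \<alpha>_le: "\<alpha> x \<le> 1"
  using c_pos \<alpha>_bounds[of x] by auto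

lemma fugacity_bounds: "0 \<le> \<phi> / \<alpha> x" "\<phi> / \<alpha> x < r_inf"
proof -
  have "r_inf * c \<le> r_inf * \<alpha> x" using \<alpha>_bounds[of x] r_inf_positive by auto
  then show "0 \<le> \<phi> / \<alpha> x" "\<phi> / \<alpha> x < r_inf"
    using \<phi>_bounds \<alpha>_pos[of x] by (auto simp: field_simps)
qed

lemma summable_partition_fun:
  assumes "0 \<le> \<psi>" "\<psi> < r_inf"
  shows "summable (\<lambda>k. \<psi> ^ k / (\<Prod>i=1..k. r i))"
proof -
  \<comment> \<open>The midpoint of \<psi> and \<open>r_inf\<close>: eventually r k exceeds it,
    which bounds the ratio of successive terms by \<open>\<psi> / ?q < 1\<close>.\<close>
  let ?q = "(\<psi> + r_inf) / 2"
  have q: "\<psi> < ?q" "?q < r_inf" "0 < ?q" using assms r_inf_positive by auto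
  obtain N where N: "\<And>k. N \<le> k \<Longrightarrow> ?q < r k"
    using order_tendstoD(1)[OF r_lim q(2)] by (auto simp: eventually_sequentially)
  have pos: "0 \<le> \<psi> ^ k / (\<Prod>i=1..k. r i)" for k
    using assms r_nonneg by (simp add: prod_nonneg)
  show ?thesis
  proof (rule summable_ratio_test)
    show "\<psi> / ?q < 1" using q by simp
    fix k assume "N \<le> k"
    then have "?q \<le> r (Suc k)" using N[of "Suc k"] by simp
    then have "\<psi> / r (Suc k) \<le> \<psi> / ?q"
      using assms q by (intro divide_left_mono) auto
    then have "\<psi> ^ k / (\<Prod>i=1..k. r i) * (\<psi> / r (Suc k)) \<le> \<psi> ^ k / (\<Prod>i=1..k. r i) * (\<psi> / ?q)"
      using pos by (intro mult_left_mono)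
    moreover have "\<psi> ^ Suc k / (\<Prod>i=1..Suc k. r i) = \<psi> ^ k / (\<Prod>i=1..k. r i) * (\<psi> / r (Suc k))"
      by simp
    ultimately show "norm (\<psi> ^ Suc k / (\<Prod>i=1..Suc k. r i)) \<le> \<psi> / ?q * norm (\<psi> ^ k / (\<Prod>i=1..k. r i))"
      using pos[of k] pos[of "Suc k"] by (simp only: real_norm_def abs_of_nonneg mult.commute)
  qed
qed

lemma partition_fun_pos:
  assumes "0 \<le> \<psi>" "\<psi> < r_inf"
  shows "0 < partition_fun r \<psi>"
  unfolding partition_fun_def
  using assms r_nonneg
  by (intro suminf_pos2[where i = 0] summable_partition_fun) (auto simp: prod_nonneg)

definition weight :: "int ^ 'd \<Rightarrow> nat \<Rightarrow> real" where
  "weight x k = 1 / partition_fun r (\<phi> / \<alpha> x) * ((\<phi> / \<alpha> x) ^ k / (\<Prod>i=1..k. r i))"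

definition marg :: "int ^ 'd \<Rightarrow> nat pmf" where
  "marg x = embed_pmf (weight x)"

lemma weight_nonneg: "0 \<le> weight x k"
  using partition_fun_pos[OF fugacity_bounds, of x] fugacity_bounds[of x] r_nonneg
  unfolding weight_def by (simp add: prod_nonneg)

lemma pmf_marg: "pmf (marg x) k = weight x k"
  unfolding marg_def
proof (rule pmf_embed_pmf[OF weight_nonneg])
  note s = summable_partition_fun[OF fugacity_bounds, of x]
  have w: "weight x = (\<lambda>k. 1 / partition_fun r (\<phi> / \<alpha> x) * ((\<phi> / \<alpha> x) ^ k / (\<Prod>i=1..k. r i)))"
    by (simp add: weight_def fun_eq_iff)
  have "summable (weight x)" unfolding w by (rule summable_mult[OF s])
  moreover have "(\<Sum>k. weight x k) = 1"
    unfolding w suminf_mult[OF s] using partition_fun_pos[OF fugacity_bounds, of x]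
    by (simp add: partition_fun_def)
  ultimately show "(\<integral>\<^sup>+k. ennreal (weight x k) \<partial>count_space UNIV) = 1"
    using suminf_ennreal2[of "weight x", OF weight_nonneg] by (simp add: nn_integral_count_space_nat)
qed

lemma site_marginal_eq_marg: "site_marginal r (\<phi> / \<alpha> x) = measure_pmf (marg x)"
  by (simp add: site_marginal_def measure_pmf_eq_density pmf_marg weight_def)

sublocale zrp_kernel r \<alpha> r_inf \<phi> marg p
proof
  show "\<alpha> x * r k \<le> r_inf" for x k
    using \<alpha>_pos[of x] \<alpha>_le[of x] r_nonneg[of k] r_le[of k]
    by (meson mult_left_le_one_le order_trans less_imp_le)
  \<comment> \<open>Consecutive weights differ by the factor \<open>\<phi> / \<alpha> x\<close>
    divided by \<open>r (Suc k)\<close>; multiplication by \<open>\<alpha> x * r (Suc k)\<close>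
    leaves \<phi>.\<close>
  show "\<alpha> x * r (Suc k) * pmf (marg x) (Suc k) = \<phi> * pmf (marg x) k" for x k
    using r_Suc_pos[of k] \<alpha>_pos[of x] by (simp add: pmf_marg weight_def)
  show "0 \<le> \<alpha> x * r k" for x k
    using r_nonneg[of k] \<alpha>_pos[of x] by simp
qed (use r_zero r_inf_positive \<phi>_bounds in simp_all)

section \<open>The independent ingredients\<close>

lemmas randomness_conjuncts = randomness[unfolded zrp_randomness_def]

lemma poisson_epochs: "poisson_point_process M r_inf (T x)"
  using randomness_conjuncts by (elim conjE allE)

lemma measurable_ingredients [measurable]:
  "\<eta>0 \<in> measurable M config_space" "T x i \<in> borel_measurable M" "U x i \<in> borel_measurable M"
  "Y x i \<in> measurable M (count_space UNIV)"
proof -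
  show "\<eta>0 \<in> measurable M config_space"
    using randomness_conjuncts by (elim conjE)
  show "T x i \<in> borel_measurable M"
    using poisson_epochs[of x, unfolded poisson_point_process_def] by (elim conjE) (erule allE)
  have "\<forall>x i. U x i \<in> borel_measurable M \<and> distr M borel (U x i) = uniform_measure lborel {0..r_inf}"
    using randomness_conjuncts by (elim conjE)
  then show "U x i \<in> borel_measurable M" by simp
  have "\<forall>x i. Y x i \<in> measurable M (count_space UNIV) \<and>
      (\<forall>y. measure M {\<omega> \<in> space M. Y x i \<omega> = y} = pmf p (y - x))"
    using randomness_conjuncts by (elim conjE)
  then show "Y x i \<in> measurable M (count_space UNIV)" by simp
qed

lemma AE_epochs_regular:
  "AE \<omega> in M. \<forall>x. 0 < T x 0 \<omega> \<and> strict_mono (\<lambda>i. T x i \<omega>) \<and> filterlim (\<lambda>i. T x i \<omega>) at_top sequentially"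
proof -
  have "AE \<omega> in M. 0 < T x 0 \<omega> \<and> strict_mono (\<lambda>i. T x i \<omega>) \<and>
      filterlim (\<lambda>i. T x i \<omega>) at_top sequentially" for x
    using poisson_epochs[of x, unfolded poisson_point_process_def] by (elim conjE)
  then show ?thesis by (simp only: AE_all_countable) blast
qed

lemma AE_displacement: "AE \<omega> in M. \<forall>x i. Y x i \<omega> - x \<in> \<N>"
proof -
  have "AE \<omega> in M. \<forall>x i y. y - x \<notin> \<N> \<longrightarrow> Y x i \<omega> \<noteq> y"
    unfolding AE_all_countable
  proof (intro allI AE_impI)
    fix x i y assume "y - x \<notin> \<N>"
    then have "pmf p (y - x) = 0" using finite_range(2) by (auto simp: pmf_eq_0_set_pmf)
    then have "prob {\<omega> \<in> space M. Y x i \<omega> = y} = 0"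
      using randomness by (simp add: zrp_randomness_def)
    then have "AE \<omega> in M. \<omega> \<notin> {\<omega> \<in> space M. Y x i \<omega> = y}"
      by (subst prob_eq_0[symmetric]) auto
    then show "AE \<omega> in M. Y x i \<omega> \<noteq> y"
      using AE_space by eventually_elim auto
  qed
  then show ?thesis by eventually_elim blast
qed

lemma prob_threshold:
  assumes "0 \<le> a" "a \<le> r_inf"
  shows "prob {\<omega> \<in> space M. U x i \<omega> < a} = a / r_inf"
proof -
  have "prob {\<omega> \<in> space M. U x i \<omega> < a} = measure (distr M borel (U x i)) {..<a}"
    by (subst measure_distr) (auto simp: vimage_def Int_def conj_commute)
  also have "distr M borel (U x i) = uniform_measure lborel {0..r_inf}"
    using randomness by (simp add: zrp_randomness_def)
  also have "measure \<dots> {..<a} = measure lborel ({0..r_inf} \<inter> {..<a}) / measure lborel {0..r_inf}"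
    using r_inf_positive by (intro measure_uniform_measure) auto
  also have "{0..r_inf} \<inter> {..<a} = {0..<a}" using assms by auto
  finally show ?thesis using assms r_inf_positive by simp
qed

text \<open>The information carried by a family of ingredients. Variables of different types are
  treated alike in this form, and independence reduces to disjointness of the index sets.\<close>

definition info :: "(int ^ 'd) ingredient set \<Rightarrow> 'w measure" where
  "info J = sigma (space M) (\<Union>j\<in>J. ingredient_events M \<eta>0 T U Y j)"

lemma ingredient_events_subset: "ingredient_events M \<eta>0 T U Y j \<subseteq> Pow (space M)"
  by (cases j) (simp_all add: sets_vimage_algebra_subset)

lemma space_info [simp]: "space (info J) = space M"
  using ingredient_events_subset by (auto simp: info_def intro!: space_measure_of)

lemma sets_info: "sets (info J) = sigma_sets (space M) (\<Union>j\<in>J. ingredient_events M \<eta>0 T U Y j)"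
  using ingredient_events_subset by (auto simp: info_def intro!: sets_measure_of)

lemma indep_ingredients: "indep_sets (ingredient_events M \<eta>0 T U Y) UNIV"
  using randomness by (simp add: zrp_randomness_def)

lemma indep_epochs: "indep_sets (\<lambda>x. ingredient_events M \<eta>0 T U Y (Epochs x)) UNIV"
proof (rule indep_setsI)
  show "ingredient_events M \<eta>0 T U Y (Epochs x) \<subseteq> events" for x
    using indep_ingredients unfolding indep_sets_def by blast
  fix A J assume J: "J \<noteq> {}" "finite J" and A: "\<forall>x\<in>J. A x \<in> ingredient_events M \<eta>0 T U Y (Epochs x)"
  define B where "B j = A (case j of Epochs x \<Rightarrow> x | _ \<Rightarrow> undefined)" for j :: "(int ^ 'd) ingredient"
  have "prob (\<Inter>j\<in>Epochs ` J. B j) = (\<Prod>j\<in>Epochs ` J. prob (B j))"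
    using J A by (intro indep_setsD[OF indep_ingredients]) (auto simp: B_def simp del: ingredient_events.simps)
  then show "prob (\<Inter>x\<in>J. A x) = (\<Prod>x\<in>J. prob (A x))"
    by (simp add: B_def prod.reindex inj_on_def)
qed

lemma sets_info_mono: "J \<subseteq> K \<Longrightarrow> sets (info J) \<subseteq> sets (info K)"
  unfolding sets_info by (intro sigma_sets_mono') auto

lemma sets_info_events: "A \<in> sets (info J) \<Longrightarrow> A \<in> events"
proof -
  have "(\<Union>j\<in>J. ingredient_events M \<eta>0 T U Y j) \<subseteq> events"
    using indep_ingredients unfolding indep_sets_def by blast
  from sets.sigma_sets_subset[OF this]
  show "A \<in> sets (info J) \<Longrightarrow> A \<in> events" unfolding sets_info by blast
qed

lemma prob_info_disjoint:
  assumes "A \<in> sets (info J)" "B \<in> sets (info K)" "J \<inter> K = {}"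
  shows "prob (A \<inter> B) = prob A * prob B"
proof -
  let ?F = "ingredient_events M \<eta>0 T U Y"
  let ?I = "case_bool J K"
  have "indep_sets (\<lambda>b. sigma_sets (space M) (\<Union>j\<in>?I b. ?F j)) UNIV"
  proof (rule indep_sets_collect_sigma)
    show "indep_sets ?F (\<Union>b\<in>UNIV. ?I b)"
      using indep_ingredients by (rule indep_sets_mono_index[rotated]) auto
    show "disjoint_family_on ?I UNIV"
      using assms(3) by (auto simp: disjoint_family_on_def split: bool.splits)
    show "Int_stable (?F j)" for j
      by (cases j) (simp_all add: sets.Int_stable)
  qed
  moreover have "(\<lambda>b. sigma_sets (space M) (\<Union>j\<in>?I b. ?F j)) = case_bool (sets (info J)) (sets (info K))"
    by (auto simp: fun_eq_iff sets_info split: bool.split)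
  ultimately have "indep_set (sets (info J)) (sets (info K))"
    by (simp add: indep_set_def)
  then show ?thesis using assms(1,2) by (rule indep_setD)
qed

lemma measurable_info:
  assumes "f \<in> measurable A N" "space A = space M" "sets A = ingredient_events M \<eta>0 T U Y j" "j \<in> J"
  shows "f \<in> measurable (info J) N"
proof (rule measurableI)
  fix B assume "B \<in> sets N"
  then have "f -` B \<inter> space M \<in> ingredient_events M \<eta>0 T U Y j"
    using measurable_sets[OF assms(1)] assms(2,3) by auto
  then show "f -` B \<inter> space (info J) \<in> sets (info J)"
    using assms(4) by (auto simp: sets_info intro: sigma_sets.Basic)
qed (use measurable_space[OF assms(1)] assms(2) in auto)

lemma measurable_info_ingredients:
  shows "Initial \<in> J \<Longrightarrow> \<eta>0 \<in> measurable (info J) config_space"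
    and "Epochs x \<in> J \<Longrightarrow> T x i \<in> borel_measurable (info J)"
    and "Threshold x i \<in> J \<Longrightarrow> U x i \<in> borel_measurable (info J)"
    and "Destination x i \<in> J \<Longrightarrow> Y x i \<in> measurable (info J) (count_space UNIV)"
proof -
  assume "Epochs x \<in> J"
  let ?A = "vimage_algebra (space M) (\<lambda>\<omega> i. T x i \<omega>) (\<Pi>\<^sub>M i\<in>UNIV. borel)"
  have "(\<lambda>\<omega> i. T x i \<omega>) \<in> measurable ?A (\<Pi>\<^sub>M i\<in>UNIV. borel)"
    by (rule measurable_vimage_algebra1) (auto simp: space_PiM)
  from measurable_compose[OF this measurable_component_singleton[of i]]
  have "T x i \<in> borel_measurable ?A" by simp
  then show "T x i \<in> borel_measurable (info J)"
    by (rule measurable_info[where j = "Epochs x"]) (use \<open>Epochs x \<in> J\<close> in auto)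
next
  assume "Initial \<in> J"
  then show "\<eta>0 \<in> measurable (info J) config_space"
    by (intro measurable_info[where j = Initial and A = "vimage_algebra (space M) \<eta>0 config_space"]
        measurable_vimage_algebra1) (auto simp: config_space_def space_PiM)
next
  assume "Threshold x i \<in> J"
  then show "U x i \<in> borel_measurable (info J)"
    by (intro measurable_info[where j = "Threshold x i" and A = "vimage_algebra (space M) (U x i) borel"]
        measurable_vimage_algebra1) auto
next
  assume "Destination x i \<in> J"
  then show "Y x i \<in> measurable (info J) (count_space UNIV)"
    by (intro measurable_info[where j = "Destination x i" and
          A = "vimage_algebra (space M) (Y x i) (count_space UNIV)"]
        measurable_vimage_algebra1) auto
qed

end

section \<open>The law of the modified process\<close>

text \<open>\<open>exp (- y) * (1 + y)\<close> is the probability that a Poisson variable of mean y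
  is at most 1. Since \<open>exp (- y) \<ge> 1 - y\<close>, it is at least
  \<open>1 - y\<^sup>2\<close> for y at most 1, and Bernoulli's inequality handles the power; for y
  > 1 the left side is negative unless m = 0.\<close>

lemma exp_Bernoulli_bound:
  fixes y :: real
  assumes "0 \<le> y"
  shows "1 - real m * y\<^sup>2 \<le> (exp (- y) * (1 + y)) ^ m"
proof (cases "y \<le> 1")
  case True
  have y2: "y\<^sup>2 \<le> 1" using assms True by (simp add: power_le_one)
  have "1 + real m * (- y\<^sup>2) \<le> (1 + - y\<^sup>2) ^ m"
    using y2 by (intro Bernoulli_inequality) simp
  also have "\<dots> \<le> (exp (- y) * (1 + y)) ^ m"
  proof (rule power_mono)
    have "(1 - y) * (1 + y) \<le> exp (- y) * (1 + y)"
      using exp_ge_add_one_self[of "- y"] assms by (intro mult_right_mono) auto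
    then show "1 + - y\<^sup>2 \<le> exp (- y) * (1 + y)"
      by (simp add: algebra_simps power2_eq_square)
  qed (use y2 in simp)
  finally show ?thesis by simp
next
  case False
  show ?thesis
  proof (cases "m = 0")
    case False
    have "1 \<le> y\<^sup>2" using \<open>\<not> y \<le> 1\<close> by (simp add: one_le_power)
    then have "1 * 1 \<le> real m * y\<^sup>2" using False by (intro mult_mono) auto
    moreover have "0 \<le> (exp (- y) * (1 + y)) ^ m" using assms by simp
    ultimately show ?thesis by simp
  qed simp
qed

lemma map_fst_label_epochs: "map fst (label_epochs s) = map the (filter (\<lambda>z. z \<noteq> None) s)"
  by (induction s rule: rev_induct) (auto simp: label_epochs_snoc split: option.split)

text \<open>Replaces the displacement by the destination, so that the kernel is driven by the pair
  of marks attached to an epoch at x.\<close>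

lemma (in zrp_kernel) jump_kernel_eq_pair:
  "jump_kernel \<Lambda> x \<zeta> = pair_pmf (bernoulli_pmf (jump_prob x \<zeta>)) (map_pmf ((+) x) p) \<bind>
     (\<lambda>(b, y). return_pmf (if b then move_particle x (box_shift \<Lambda> (y - x) x) \<zeta> else \<zeta>))"
  unfolding jump_kernel_def
  by (subst bind_commute_pmf) (simp add: pair_pmf_def map_pmf_def bind_assoc_pmf bind_return_pmf cong: if_cong)

section \<open>The process in a box and its law along a fixed list of epochs\<close>

context zrp_setup
begin

definition box_config :: "(int ^ 'd) set \<Rightarrow> 'w \<Rightarrow> (int ^ 'd \<Rightarrow> nat)" where
  "box_config \<Lambda> \<omega> = (\<lambda>x. if x \<in> \<Lambda> then \<eta>0 \<omega> x else 0)"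

definition box_fold ::
    "(int ^ 'd) set \<Rightarrow> ((int ^ 'd) \<times> nat) list \<Rightarrow> (int ^ 'd \<Rightarrow> nat) \<Rightarrow> 'w \<Rightarrow> (int ^ 'd \<Rightarrow> nat)" where
  "box_fold \<Lambda> es \<zeta> \<omega> =
     fold (epoch_update r \<alpha> (\<lambda>x i. U x i \<omega>) (box_dst \<Lambda> (\<lambda>x i. Y x i \<omega>))) es \<zeta>"

definition box_process :: "(int ^ 'd) set \<Rightarrow> real \<Rightarrow> 'w \<Rightarrow> (int ^ 'd \<Rightarrow> nat)" where
  "box_process \<Lambda> t \<omega> = run_epochs r \<alpha> (\<lambda>x i. T x i \<omega>) (\<lambda>x i. U x i \<omega>) (box_dst \<Lambda> (\<lambda>x i. Y x i \<omega>))
     (epochs_in \<Lambda> (\<lambda>x i. T x i \<omega>) 0 t) (box_config \<Lambda> \<omega>)"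

lemma measurable_box_config [measurable]: "box_config \<Lambda> \<in> measurable M config_space"
  by (rule measurable_config_spaceI) (auto simp: box_config_def)

lemma measurable_box_shift [measurable]:
  "(\<lambda>\<omega>. box_shift \<Lambda> (Y x i \<omega> - x) x) \<in> measurable M (count_space UNIV)"
  by (rule measurable_compose[OF measurable_ingredients(4)]) simp

lemma box_dst_eq: "box_dst \<Lambda> (\<lambda>x i. Y x i \<omega>) = (\<lambda>x i. box_shift \<Lambda> (Y x i \<omega> - x) x)"
  by (simp add: fun_eq_iff box_dst_def)

lemma measurable_box_fold [measurable]:
  assumes "\<eta> \<in> measurable M config_space"
  shows "(\<lambda>\<omega>. box_fold \<Lambda> es (\<eta> \<omega>) \<omega>) \<in> measurable M config_space"
  unfolding box_fold_def box_dst_eq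
  by (rule measurable_fold_epoch_update[OF assms measurable_ingredients(3) measurable_box_shift])

lemma pred_epochs_in: "Measurable.pred M (\<lambda>\<omega>. e \<in> epochs_in \<Lambda> (\<lambda>x i. T x i \<omega>) a b)"
  by (cases e) (simp add: epochs_in_def)

lemma measurable_box_process [measurable]: "box_process \<Lambda> t \<in> measurable M config_space"
  unfolding box_process_def[abs_def] box_dst_eq
  by (rule measurable_run_epochs[OF measurable_ingredients(2) pred_epochs_in measurable_box_config
        measurable_ingredients(3) measurable_box_shift])

lemma prob_box_config:
  assumes "finite \<Lambda>" and supp: "\<And>x. x \<notin> \<Lambda> \<Longrightarrow> \<zeta> x = 0"
  shows "prob {\<omega> \<in> space M. box_config \<Lambda> \<omega> = \<zeta>} = pmf (box_law \<Lambda>) \<zeta>"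
proof -
  let ?P = "\<Pi>\<^sub>M x\<in>UNIV. measure_pmf (marg x)"
  let ?E = "prod_emb UNIV (\<lambda>x. measure_pmf (marg x)) \<Lambda> (\<Pi>\<^sub>E x\<in>\<Lambda>. {\<zeta> x})"
  have P: "distr M config_space \<eta>0 = ?P"
    using initial_law by (simp add: zrp_product_measure_def site_marginal_eq_marg)
  have sets: "?E \<in> sets config_space"
  proof -
    have "?E \<in> sets ?P" using assms(1) by (intro sets_PiM_I) auto
    then show ?thesis unfolding P[symmetric] by simp
  qed
  have E: "\<eta> \<in> ?E \<longleftrightarrow> (\<forall>x\<in>\<Lambda>. \<eta> x = \<zeta> x)" for \<eta>
    by (auto simp: prod_emb_def space_PiM PiE_iff)
  have "{\<omega> \<in> space M. box_config \<Lambda> \<omega> = \<zeta>} = \<eta>0 -` ?E \<inter> space M"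
    using supp E by (auto simp: box_config_def fun_eq_iff)
  then have "emeasure M {\<omega> \<in> space M. box_config \<Lambda> \<omega> = \<zeta>} = emeasure ?P ?E"
    unfolding P[symmetric] using sets by (simp add: emeasure_distr)
  also have "\<dots> = (\<Prod>x\<in>\<Lambda>. emeasure (measure_pmf (marg x)) {\<zeta> x})"
    using assms(1) by (intro emeasure_PiM_emb) (auto intro: measure_pmf.prob_space_axioms)
  also have "\<dots> = ennreal (pmf (box_law \<Lambda>) \<zeta>)"
    using assms by (simp add: emeasure_pmf_single prod_ennreal box_law_def pmf_Pi')
  finally show ?thesis by (simp add: emeasure_eq_measure)
qed

lemma prob_marks:
  "prob {\<omega> \<in> space M. (U x i \<omega> < \<alpha> x * r (\<zeta> x), Y x i \<omega>) = v} =
     pmf (pair_pmf (bernoulli_pmf (jump_prob x \<zeta>)) (map_pmf ((+) x) p)) v" (is "prob ?A = _")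
proof -
  obtain b y where v: "v = (b, y)" by (cases v)
  let ?B = "{\<omega> \<in> space (info {Threshold x i}). (U x i \<omega> < \<alpha> x * r (\<zeta> x)) = b}"
  let ?C = "{\<omega> \<in> space (info {Destination x i}). Y x i \<omega> = y}"
  have [measurable]: "U x i \<in> borel_measurable (info {Threshold x i})"
    "Y x i \<in> measurable (info {Destination x i}) (count_space UNIV)"
    by (auto intro: measurable_info_ingredients)
  have "?B \<in> sets (info {Threshold x i})" "?C \<in> sets (info {Destination x i})"
    by measurable
  then have "prob (?B \<inter> ?C) = prob ?B * prob ?C"
    by (rule prob_info_disjoint) simp
  moreover have "?A = ?B \<inter> ?C" by (auto simp: v)
  moreover have "prob ?B = pmf (bernoulli_pmf (jump_prob x \<zeta>)) b"
  proof -
    have *: "prob {\<omega> \<in> space M. U x i \<omega> < \<alpha> x * r (\<zeta> x)} = jump_prob x \<zeta>"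
      unfolding jump_prob_def by (rule prob_threshold[OF rate_nonneg rate_le])
    show ?thesis
    proof (cases b)
      case True
      then show ?thesis using * jump_prob_bounds by simp
    next
      case False
      have "prob {\<omega> \<in> space M. \<not> U x i \<omega> < \<alpha> x * r (\<zeta> x)} = 1 - jump_prob x \<zeta>"
        unfolding *[symmetric] by (rule prob_neg) measurable
      then show ?thesis using False jump_prob_bounds by simp
    qed
  qed
  moreover have "prob ?C = pmf (map_pmf ((+) x) p) y"
  proof -
    have "\<forall>x i. Y x i \<in> measurable M (count_space UNIV) \<and>
        (\<forall>y. measure M {\<omega> \<in> space M. Y x i \<omega> = y} = pmf p (y - x))"
      using randomness_conjuncts by (elim conjE)
    then have "prob {\<omega> \<in> space M. Y x i \<omega> = y} = pmf p (y - x)" by blast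
    also have "\<dots> = pmf (map_pmf ((+) x) p) (x + (y - x))"
      by (rule pmf_map_inj'[symmetric]) simp
    finally show ?thesis by simp
  qed
  ultimately show ?thesis by (simp add: v pmf_pair)
qed

lemma box_fold_eq_event:
  assumes "\<eta> \<in> measurable M config_space"
  shows "{\<omega> \<in> space M. box_fold \<Lambda> es (\<eta> \<omega>) \<omega> = \<xi>} \<in> events"
  using pred_config_eq[OF measurable_box_fold[OF assms]] by (simp add: pred_def)

lemma const_config_measurable: "(\<lambda>_. \<zeta>) \<in> measurable N config_space"
  by (rule measurable_config_spaceI) simp

text \<open>The induction reveals the marks one epoch at a time. \<open>H\<close> is an event about
  the ingredients \<open>J\<close> seen so far; the marks of the first epoch are not among them,
  hence independent of \<open>H\<close>. Splitting by their outcome v turns the first update into an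
  average over the kernel, and the two marks join \<open>J\<close>. Distinctness of the list keeps
  the later marks unseen.\<close>

lemma emeasure_box_fold:
  assumes "H \<in> sets (info J)" "distinct es"
    and "\<And>x i. (x, i) \<in> set es \<Longrightarrow> Threshold x i \<notin> J \<and> Destination x i \<notin> J"
  shows "emeasure M (H \<inter> {\<omega> \<in> space M. box_fold \<Lambda> es \<zeta> \<omega> = \<xi>}) =
    emeasure M H * ennreal (pmf (site_kernel \<Lambda> (map fst es) \<zeta>) \<xi>)"
  using assms
proof (induction es arbitrary: H J \<zeta>)
  case Nil
  have "H \<subseteq> space M" using sets.sets_into_space[OF Nil(1)] by simp
  then show ?case by (cases "\<zeta> = \<xi>") (simp_all add: box_fold_def Int_absorb2)
next
  case (Cons e es)
  obtain x i where e: "e = (x, i)" by (cases e)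
  let ?q = "pair_pmf (bernoulli_pmf (jump_prob x \<zeta>)) (map_pmf ((+) x) p)"
  define g where "g = (\<lambda>(b, y). if b then move_particle x (box_shift \<Lambda> (y - x) x) \<zeta> else \<zeta>)"
  \<comment> \<open>Recording the outcome of the threshold test in place of the threshold keeps
    \<open>V\<close> countably valued; as \<zeta> is fixed, \<open>V\<close> depends on the marks of
    this epoch alone.\<close>
  define V where "V \<omega> = (U x i \<omega> < \<alpha> x * r (\<zeta> x), Y x i \<omega>)" for \<omega>
  let ?K = "{Threshold x i, Destination x i}"
  let ?F = "\<lambda>v. {\<omega> \<in> space M. V \<omega> = v}"
  have F: "?F v \<in> sets (info ?K)" for v
  proof -
    have [measurable]: "U x i \<in> borel_measurable (info ?K)"
      "Y x i \<in> measurable (info ?K) (count_space UNIV)"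
      by (simp_all add: measurable_info_ingredients)
    obtain b y where v: "v = (b, y)" by (cases v)
    have "{\<omega> \<in> space (info ?K). (U x i \<omega> < \<alpha> x * r (\<zeta> x)) = b \<and> Y x i \<omega> = y} \<in> sets (info ?K)"
      by measurable
    then show ?thesis by (simp only: space_info V_def v prod.inject)
  qed
  have J: "J \<inter> ?K = {}" using Cons.prems(3)[of x i] by (auto simp: e)
  have HF: "H \<inter> ?F v \<in> sets (info (J \<union> ?K))" for v
    using Cons.prems(1) F[of v] sets_info_mono[of J "J \<union> ?K"] sets_info_mono[of ?K "J \<union> ?K"]
    by (intro sets.Int) auto
  have emHF: "emeasure M (H \<inter> ?F v) = emeasure M H * ennreal (pmf ?q v)" for v
    using prob_info_disjoint[OF Cons.prems(1) F J, of v] prob_marks[of x i \<zeta> v]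
    by (simp add: emeasure_eq_measure V_def ennreal_mult)
  have step: "box_fold \<Lambda> (e # es) \<zeta> \<omega> = box_fold \<Lambda> es (g (V \<omega>)) \<omega>" for \<omega>
    by (simp add: box_fold_def e epoch_update_def g_def V_def box_dst_def)
  let ?A = "H \<inter> {\<omega> \<in> space M. box_fold \<Lambda> (e # es) \<zeta> \<omega> = \<xi>}"
  have "?A \<in> events"
    by (intro sets.Int sets_info_events[OF Cons.prems(1)] box_fold_eq_event const_config_measurable)
  then have "emeasure M ?A = (\<integral>\<^sup>+v. emeasure M (?A \<inter> ?F v) \<partial>count_space UNIV)"
    by (rule emeasure_eq_nn_integral_fibres) (simp_all add: sets_info_events[OF F])
  also have "\<dots> = (\<integral>\<^sup>+v. emeasure M H * (ennreal (pmf ?q v) *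
      ennreal (pmf (site_kernel \<Lambda> (map fst es) (g v)) \<xi>)) \<partial>count_space UNIV)"
  proof (rule nn_integral_cong)
    fix v
    have "?A \<inter> ?F v = (H \<inter> ?F v) \<inter> {\<omega> \<in> space M. box_fold \<Lambda> es (g v) \<omega> = \<xi>}"
      by (auto simp: step)
    then have "emeasure M (?A \<inter> ?F v) =
        emeasure M (H \<inter> ?F v) * ennreal (pmf (site_kernel \<Lambda> (map fst es) (g v)) \<xi>)"
      using Cons.IH[OF HF, of v "g v"] Cons.prems(2,3) by (auto simp: e)
    then show "emeasure M (?A \<inter> ?F v) = emeasure M H * (ennreal (pmf ?q v) *
        ennreal (pmf (site_kernel \<Lambda> (map fst es) (g v)) \<xi>))"
      by (simp add: emHF mult.assoc)
  qed
  also have "\<dots> = emeasure M H * (\<integral>\<^sup>+v. ennreal (pmf (site_kernel \<Lambda> (map fst es) (g v)) \<xi>) \<partial>?q)"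
    by (simp add: nn_integral_cmult nn_integral_measure_pmf)
  also have "\<dots> = emeasure M H * ennreal (pmf (?q \<bind> (\<lambda>v. site_kernel \<Lambda> (map fst es) (g v))) \<xi>)"
    by (simp only: ennreal_pmf_bind)
  also have "?q \<bind> (\<lambda>v. site_kernel \<Lambda> (map fst es) (g v)) = site_kernel \<Lambda> (map fst (e # es)) \<zeta>"
    by (simp add: e jump_kernel_eq_pair bind_assoc_pmf bind_return_pmf g_def case_prod_beta)
  finally show ?case .
qed

text \<open>The initial configuration is one more independent ingredient, revealed before the marks.
  The fibres run over the support of \<open>box_law\<close> only, which gives an inclusion of events
  and thus an inequality.\<close>

lemma emeasure_box_fold_initial:
  assumes "finite \<Lambda>" and E: "E \<in> sets (info (range Epochs))" and "distinct es"
  shows "emeasure M E * ennreal (pmf (box_law \<Lambda> \<bind> site_kernel \<Lambda> (map fst es)) \<xi>) \<le>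
    emeasure M (E \<inter> {\<omega> \<in> space M. box_fold \<Lambda> es (box_config \<Lambda> \<omega>) \<omega> = \<xi>})"
proof -
  let ?C = "set_pmf (box_law \<Lambda>)"
  define I where "I \<zeta> = {\<omega> \<in> space M. box_config \<Lambda> \<omega> = \<zeta>}" for \<zeta>
  define B where "B \<zeta> = (E \<inter> I \<zeta>) \<inter> {\<omega> \<in> space M. box_fold \<Lambda> es \<zeta> \<omega> = \<xi>}" for \<zeta>
  have I: "I \<zeta> \<in> sets (info {Initial})" for \<zeta>
  proof -
    have "\<eta>0 \<in> measurable (info {Initial}) config_space"
      by (rule measurable_info_ingredients) simp
    then have "box_config \<Lambda> \<in> measurable (info {Initial}) config_space"
      unfolding box_config_def[abs_def]
      by (intro measurable_config_spaceI) (auto dest: measurable_config_spaceD)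
    from pred_config_eq[OF this, of \<zeta>] show ?thesis by (simp add: I_def pred_def)
  qed
  have EI: "E \<inter> I \<zeta> \<in> sets (info (insert Initial (range Epochs)))" for \<zeta>
    using E I[of \<zeta>] sets_info_mono[of "{Initial}" "insert Initial (range Epochs)"]
      sets_info_mono[of "range Epochs" "insert Initial (range Epochs)"]
    by (intro sets.Int) auto
  have B: "emeasure M (B \<zeta>) = emeasure M E *
      (ennreal (pmf (box_law \<Lambda>) \<zeta>) * ennreal (pmf (site_kernel \<Lambda> (map fst es) \<zeta>) \<xi>))"
    if "\<zeta> \<in> ?C" for \<zeta>
  proof -
    have "\<zeta> x = 0" if "x \<notin> \<Lambda>" for x
      using \<open>\<zeta> \<in> ?C\<close> that pmf_Pi_outside[OF assms(1), of \<zeta> 0 marg]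
      unfolding box_law_def set_pmf_iff by blast
    then have "prob (E \<inter> I \<zeta>) = prob E * pmf (box_law \<Lambda>) \<zeta>"
      using prob_info_disjoint[OF E I[of \<zeta>]] prob_box_config[OF assms(1), of \<zeta>] by (auto simp: I_def)
    then have "emeasure M (E \<inter> I \<zeta>) = emeasure M E * ennreal (pmf (box_law \<Lambda>) \<zeta>)"
      by (simp add: emeasure_eq_measure ennreal_mult)
    moreover have "emeasure M (B \<zeta>) =
        emeasure M (E \<inter> I \<zeta>) * ennreal (pmf (site_kernel \<Lambda> (map fst es) \<zeta>) \<xi>)"
      unfolding B_def by (rule emeasure_box_fold[OF EI assms(3)]) auto
    ultimately show ?thesis by (simp add: mult.assoc)
  qed
  have meas: "B \<zeta> \<in> events" for \<zeta>
    unfolding B_def by (intro sets.Int[OF sets_info_events[OF EI]] box_fold_eq_event const_config_measurable)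
  have "ennreal (pmf (box_law \<Lambda> \<bind> site_kernel \<Lambda> (map fst es)) \<xi>) =
      (\<integral>\<^sup>+\<zeta>. ennreal (pmf (box_law \<Lambda>) \<zeta>) * ennreal (pmf (site_kernel \<Lambda> (map fst es) \<zeta>) \<xi>) \<partial>count_space UNIV)"
    by (simp add: ennreal_pmf_bind nn_integral_measure_pmf)
  also have "\<dots> = (\<integral>\<^sup>+\<zeta>. ennreal (pmf (box_law \<Lambda>) \<zeta>) * ennreal (pmf (site_kernel \<Lambda> (map fst es) \<zeta>) \<xi>) \<partial>count_space ?C)"
    by (rule nn_integral_count_space_eq) (auto simp: set_pmf_iff)
  finally have "emeasure M E * ennreal (pmf (box_law \<Lambda> \<bind> site_kernel \<Lambda> (map fst es)) \<xi>) =
      (\<integral>\<^sup>+\<zeta>. emeasure M E * (ennreal (pmf (box_law \<Lambda>) \<zeta>) *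
        ennreal (pmf (site_kernel \<Lambda> (map fst es) \<zeta>) \<xi>)) \<partial>count_space ?C)"
    by (simp add: nn_integral_cmult)
  also have "\<dots> = (\<integral>\<^sup>+\<zeta>. emeasure M (B \<zeta>) \<partial>count_space ?C)"
    by (intro nn_integral_cong) (simp add: B)
  also have "\<dots> = emeasure M (\<Union>\<zeta>\<in>?C. B \<zeta>)"
    using meas by (intro emeasure_UN_countable[symmetric]) (auto simp: disjoint_family_on_def B_def I_def)
  also have "\<dots> \<le> emeasure M (E \<inter> {\<omega> \<in> space M. box_fold \<Lambda> es (box_config \<Lambda> \<omega>) \<omega> = \<xi>})"
  proof (rule emeasure_mono)
    show "(\<Union>\<zeta>\<in>?C. B \<zeta>) \<subseteq> E \<inter> {\<omega> \<in> space M. box_fold \<Lambda> es (box_config \<Lambda> \<omega>) \<omega> = \<xi>}"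
      by (auto simp: B_def I_def)
    show "E \<inter> {\<omega> \<in> space M. box_fold \<Lambda> es (box_config \<Lambda> \<omega>) \<omega> = \<xi>} \<in> events"
      by (intro sets.Int sets_info_events[OF E] box_fold_eq_event measurable_box_config)
  qed
  finally show ?thesis .
qed

end

section \<open>Probabilities of the records of time cells\<close>

lemma prod_option_indicator:
  fixes a :: real
  assumes "finite \<Lambda>" "z \<in> insert None (Some ` \<Lambda>)"
  shows "(\<Prod>x\<in>\<Lambda>. if z = Some x then a else 1) = (if z = None then 1 else a)"
proof (cases z)
  case (Some y)
  then have "(\<Prod>x\<in>\<Lambda>. if z = Some x then a else 1) = (\<Prod>x\<in>\<Lambda>. if x = y then a else 1)"
    by (intro prod.cong) auto
  then show ?thesis using assms Some by (auto simp: prod.delta)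
qed simp

context zrp_setup
begin

text \<open>An entry names at most one site, so on this event no cell holds two epochs of sites in
  \<Lambda>.\<close>

definition cells_event :: "(int ^ 'd) set \<Rightarrow> real \<Rightarrow> (int ^ 'd) option list \<Rightarrow> 'w set" where
  "cells_event \<Lambda> h s = {\<omega> \<in> space M. \<forall>x\<in>\<Lambda>. \<forall>j<length s.
     card {i. T x i \<omega> \<in> {real j * h<..real (Suc j) * h}} = (if s ! j = Some x then 1 else 0)}"

definition cell_seqs :: "(int ^ 'd) set \<Rightarrow> nat \<Rightarrow> (int ^ 'd) option list set" where
  "cell_seqs \<Lambda> m = {s. set s \<subseteq> insert None (Some ` \<Lambda>) \<and> length s = m}"

text \<open>The probability that a Poisson variable of mean
  \<open>card \<Lambda> * (r_inf * h)\<close> is at most 1.\<close>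

definition cell_prob :: "(int ^ 'd) set \<Rightarrow> real \<Rightarrow> real" where
  "cell_prob \<Lambda> h = exp (- (card \<Lambda> * (r_inf * h))) * (1 + card \<Lambda> * (r_inf * h))"

text \<open>The conditional probability that the same Poisson variable equals 1, given that it is at
  most 1.\<close>

definition cell_rate :: "(int ^ 'd) set \<Rightarrow> real \<Rightarrow> real" where
  "cell_rate \<Lambda> h = card \<Lambda> * (r_inf * h) / (1 + card \<Lambda> * (r_inf * h))"

lemma cell_rate_bounds:
  assumes "0 \<le> h" shows "0 \<le> cell_rate \<Lambda> h" "cell_rate \<Lambda> h \<le> 1"
proof -
  have "0 \<le> card \<Lambda> * (r_inf * h)" using assms r_inf_positive by simp
  then show "0 \<le> cell_rate \<Lambda> h" "cell_rate \<Lambda> h \<le> 1" by (auto simp: cell_rate_def)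
qed

lemma finite_cell_seqs: "finite \<Lambda> \<Longrightarrow> finite (cell_seqs \<Lambda> m)"
  unfolding cell_seqs_def by (intro finite_lists_length_eq) simp

lemma set_pmf_replicate_cell_law:
  assumes "finite \<Lambda>" "\<Lambda> \<noteq> {}"
  shows "set_pmf (replicate_pmf m (cell_law \<Lambda> \<beta>)) \<subseteq> cell_seqs \<Lambda> m"
  using set_pmf_cell_law[OF assms] by (auto simp: set_replicate_pmf cell_seqs_def)

lemma measurable_epoch_count:
  assumes "\<And>i. T x i \<in> borel_measurable N"
  shows "(\<lambda>\<omega>. card {i. T x i \<omega> \<in> {a<..b}}) \<in> measurable N (count_space UNIV)"
  using assms by measurable

lemma prob_epoch_counts:
  assumes h: "0 < h" and "0 < m"
  shows "prob {\<omega> \<in> space M. \<forall>j<m. card {i. T x i \<omega> \<in> {real j * h<..real (Suc j) * h}} = k j} =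
    (\<Prod>j<m. (r_inf * h) ^ k j / fact (k j) * exp (- (r_inf * h)))"
proof -
  \<comment> \<open>Independence of the Poisson counts is available for infinite sequences of
    disjoint sets, so the cells are padded with empty sets.\<close>
  define B where "B j = (if j < m then {real j * h<..real (Suc j) * h} else {})" for j
  define X where "X j \<omega> = card {i. T x i \<omega> \<in> B j}" for j \<omega>
  have sub: "{real j * h<..real (Suc j) * h} \<subseteq> {0<..}" for j
  proof
    fix s assume "s \<in> {real j * h<..real (Suc j) * h}"
    moreover have "0 \<le> real j * h" using h by simp
    ultimately show "s \<in> {0<..}" by auto
  qed
  have B: "B j \<in> sets borel \<and> B j \<subseteq> {0<..} \<and> bounded (B j)" for j
    using sub by (auto simp: B_def bounded_Ioc)
  have less: "B i \<inter> B j = {}" if "i < j" for i j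
  proof -
    have "real (Suc i) * h \<le> real j * h" using that h by (intro mult_right_mono) auto
    then show ?thesis by (auto simp: B_def)
  qed
  have "disjoint_family B"
    unfolding disjoint_family_on_def
  proof (intro ballI impI)
    fix i j :: nat assume "i \<noteq> j"
    then show "B i \<inter> B j = {}"
      using less[of i j] less[of j i] by (cases "i < j") (simp_all add: Int_commute)
  qed
  then have indep: "indep_vars (\<lambda>_. count_space UNIV) X UNIV"
    using poisson_epochs[of x, unfolded poisson_point_process_def] B
    unfolding X_def[abs_def] by (elim conjE) (erule allE[of _ B], simp)
  have P: "prob {\<omega> \<in> space M. X j \<omega> = k j} = (r_inf * h) ^ k j / fact (k j) * exp (- (r_inf * h))"
    if "j < m" for j
  proof -
    have "\<forall>B\<in>sets borel. B \<subseteq> {0<..} \<longrightarrow> bounded B \<longrightarrow>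
        (\<forall>k. prob {\<omega> \<in> space M. card {i. T x i \<omega> \<in> B} = k} =
           (r_inf * measure lborel B) ^ k / fact k * exp (- (r_inf * measure lborel B)))"
      using poisson_epochs[of x, unfolded poisson_point_process_def] by (elim conjE)
    then have "prob {\<omega> \<in> space M. X j \<omega> = k j} =
        (r_inf * measure lborel (B j)) ^ k j / fact (k j) * exp (- (r_inf * measure lborel (B j)))"
      using B[of j] unfolding X_def by blast
    moreover have "measure lborel (B j) = h"
      using h that by (simp add: B_def algebra_simps)
    ultimately show ?thesis by simp
  qed
  have "prob (\<Inter>j\<in>{..<m}. X j -` {k j} \<inter> space M) = (\<Prod>j\<in>{..<m}. prob (X j -` {k j} \<inter> space M))"
    using \<open>0 < m\<close> by (intro indep_varsD[OF indep]) auto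
  moreover have "(\<Inter>j\<in>{..<m}. X j -` {k j} \<inter> space M) =
      {\<omega> \<in> space M. \<forall>j<m. card {i. T x i \<omega> \<in> {real j * h<..real (Suc j) * h}} = k j}"
    using \<open>0 < m\<close> by (auto simp: X_def B_def)
  moreover have "X j -` {k j} \<inter> space M = {\<omega> \<in> space M. X j \<omega> = k j}" for j by auto
  ultimately show ?thesis using P by simp
qed

lemma cells_event_info: "cells_event \<Lambda> h s \<in> sets (info (range Epochs))"
proof -
  have [measurable]: "(\<lambda>\<omega>. card {i. T x i \<omega> \<in> {a<..b}}) \<in> measurable (info (range Epochs)) (count_space UNIV)"
    for x a b by (intro measurable_epoch_count measurable_info_ingredients) auto
  have "{\<omega> \<in> space (info (range Epochs)). \<forall>x\<in>\<Lambda>. \<forall>j<length s.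
     card {i. T x i \<omega> \<in> {real j * h<..real (Suc j) * h}} = (if s ! j = Some x then 1 else 0)}
     \<in> sets (info (range Epochs))"
    by measurable
  then show ?thesis by (simp only: cells_event_def space_info)
qed

lemma cells_event_events: "cells_event \<Lambda> h s \<in> events"
  by (rule sets_info_events[OF cells_event_info])

text \<open>Counts are independent over sites and over cells. A cell contributes
  \<open>exp (- (card \<Lambda> * (r_inf * h)))\<close> times 1 for no epoch, or times
  \<open>r_inf * h\<close> for an epoch at a given site; dividing by \<open>cell_prob\<close>, the
  sum over all admissible entries, turns this into \<open>cell_law\<close>.\<close>

lemma prob_cells_event:
  assumes \<Lambda>: "finite \<Lambda>" "\<Lambda> \<noteq> {}" and h: "0 < h" and s: "s \<in> cell_seqs \<Lambda> m" and m: "0 < m"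
  shows "prob (cells_event \<Lambda> h s) =
    cell_prob \<Lambda> h ^ m * pmf (replicate_pmf m (cell_law \<Lambda> (cell_rate \<Lambda> h))) s"
proof -
  let ?l = "r_inf * h" and ?n = "real (card \<Lambda>)"
  have len: "length s = m" and set: "\<And>j. j < m \<Longrightarrow> s ! j \<in> insert None (Some ` \<Lambda>)"
    using s nth_mem[of _ s] unfolding cell_seqs_def by blast+
  have l: "0 < ?l" using h r_inf_positive by simp
  define k where "k x j = (if s ! j = Some x then 1 else 0::nat)" for x j
  define E where "E x = {\<omega> \<in> space M. \<forall>j<m. card {i. T x i \<omega> \<in> {real j * h<..real (Suc j) * h}} = k x j}" for x
  have E: "E x \<in> ingredient_events M \<eta>0 T U Y (Epochs x)" for x
  proof -
    let ?V = "vimage_algebra (space M) (\<lambda>\<omega> i. T x i \<omega>) (\<Pi>\<^sub>M i\<in>(UNIV :: nat set). (borel :: real measure))"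
    have V: "(\<lambda>\<omega> i. T x i \<omega>) \<in> measurable ?V (\<Pi>\<^sub>M i\<in>UNIV. borel)"
      by (rule measurable_vimage_algebra1) (auto simp: space_PiM)
    have "T x i \<in> borel_measurable ?V" for i
      using measurable_compose[OF V measurable_component_singleton[of i]] by simp
    then have [measurable]: "(\<lambda>\<omega>. card {i. T x i \<omega> \<in> {a<..b}}) \<in> measurable ?V (count_space UNIV)" for a b
      by (rule measurable_epoch_count)
    have "{\<omega> \<in> space ?V. \<forall>j<m. card {i. T x i \<omega> \<in> {real j * h<..real (Suc j) * h}} = k x j} \<in> sets ?V"
      by measurable
    then show ?thesis by (simp only: E_def ingredient_events.simps space_vimage_algebra)
  qed
  have "cells_event \<Lambda> h s = (\<Inter>x\<in>\<Lambda>. E x)"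
    using \<Lambda>(2) by (auto simp: cells_event_def E_def k_def len)
  also have "prob \<dots> = (\<Prod>x\<in>\<Lambda>. prob (E x))"
    using \<Lambda> E by (intro indep_setsD[OF indep_epochs]) auto
  also have "\<dots> = (\<Prod>x\<in>\<Lambda>. \<Prod>j<m. exp (- ?l) * (if s ! j = Some x then ?l else 1))"
    unfolding E_def prob_epoch_counts[OF h m] by (intro prod.cong refl) (simp add: k_def)
  also have "\<dots> = (\<Prod>j<m. \<Prod>x\<in>\<Lambda>. exp (- ?l) * (if s ! j = Some x then ?l else 1))"
    by (rule prod.swap)
  also have "\<dots> = (\<Prod>j<m. cell_prob \<Lambda> h * pmf (cell_law \<Lambda> (cell_rate \<Lambda> h)) (s ! j))"
  proof (rule prod.cong[OF refl])
    fix j assume "j \<in> {..<m}"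
    then have z: "s ! j \<in> insert None (Some ` \<Lambda>)" using set by simp
    have "(\<Prod>x\<in>\<Lambda>. exp (- ?l) * (if s ! j = Some x then ?l else 1)) =
        exp (- ?l) ^ card \<Lambda> * (if s ! j = None then 1 else ?l)"
      using prod_option_indicator[OF \<Lambda>(1) z, of ?l] by (simp add: prod.distrib)
    also have "exp (- ?l) ^ card \<Lambda> = exp (- (?n * ?l))"
      by (simp add: exp_of_nat_mult[symmetric])
    also have "exp (- (?n * ?l)) * (if s ! j = None then 1 else ?l) =
        cell_prob \<Lambda> h * pmf (cell_law \<Lambda> (cell_rate \<Lambda> h)) (s ! j)"
    proof -
      have n: "0 < ?n" using \<Lambda> by (simp add: card_gt_0_iff)
      have pos: "0 < 1 + ?n * ?l" using l by (intro add_pos_nonneg) auto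
      have b: "0 \<le> cell_rate \<Lambda> h" "cell_rate \<Lambda> h \<le> 1" using cell_rate_bounds h by auto
      have "1 - cell_rate \<Lambda> h = 1 / (1 + ?n * ?l)"
        using pos by (simp add: cell_rate_def field_simps)
      moreover have "cell_rate \<Lambda> h / card \<Lambda> = ?l / (1 + ?n * ?l)"
        using n by (simp add: cell_rate_def)
      ultimately show ?thesis
        using z pos pmf_cell_law[OF \<Lambda> b] by (auto simp: cell_prob_def)
    qed
    finally show "(\<Prod>x\<in>\<Lambda>. exp (- ?l) * (if s ! j = Some x then ?l else 1)) =
        cell_prob \<Lambda> h * pmf (cell_law \<Lambda> (cell_rate \<Lambda> h)) (s ! j)" .
  qed
  also have "\<dots> = cell_prob \<Lambda> h ^ m * pmf (replicate_pmf m (cell_law \<Lambda> (cell_rate \<Lambda> h))) s"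
    using pmf_replicate_pmf[of s "cell_law \<Lambda> (cell_rate \<Lambda> h)"] by (simp add: prod.distrib len)
  finally show ?thesis .
qed

lemma disjoint_cells_event:
  assumes "s \<in> cell_seqs \<Lambda> m" "s' \<in> cell_seqs \<Lambda> m" "s \<noteq> s'"
  shows "cells_event \<Lambda> h s \<inter> cells_event \<Lambda> h s' = {}"
proof -
  obtain j where j: "j < m" "s ! j \<noteq> s' ! j"
    using assms by (auto simp: cell_seqs_def list_eq_iff_nth_eq)
  have mem: "s ! j \<in> insert None (Some ` \<Lambda>)" "s' ! j \<in> insert None (Some ` \<Lambda>)"
  proof -
    have "s ! j \<in> set s" "s' ! j \<in> set s'"
      using assms(1,2) j(1) by (simp_all add: cell_seqs_def)
    then show "s ! j \<in> insert None (Some ` \<Lambda>)" "s' ! j \<in> insert None (Some ` \<Lambda>)"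
      using assms(1,2) unfolding cell_seqs_def by blast+
  qed
  then obtain x where x: "x \<in> \<Lambda>" "(s ! j = Some x) \<noteq> (s' ! j = Some x)"
    using j(2) by (metis imageE insertE)
  have count: "card {i. T x i \<omega> \<in> {real j * h<..real (Suc j) * h}} = (if s ! j = Some x then 1 else 0)"
    if "\<omega> \<in> cells_event \<Lambda> h s" "s \<in> cell_seqs \<Lambda> m" for s \<omega>
  proof -
    have "\<forall>x\<in>\<Lambda>. \<forall>j<length s.
        card {i. T x i \<omega> \<in> {real j * h<..real (Suc j) * h}} = (if s ! j = Some x then 1 else 0)"
      using that(1) unfolding cells_event_def mem_Collect_eq by (rule conjunct2)
    moreover have "j < length s" using that(2) j(1) by (simp add: cell_seqs_def)
    ultimately show ?thesis using x(1) by blast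
  qed
  have absurd: False if \<omega>: "\<omega> \<in> cells_event \<Lambda> h s" "\<omega> \<in> cells_event \<Lambda> h s'" for \<omega>
    using count[OF \<omega>(1) assms(1)] count[OF \<omega>(2) assms(2)] x(2) by (simp split: if_splits)
  show ?thesis
  proof (rule equals0I)
    fix \<omega> assume "\<omega> \<in> cells_event \<Lambda> h s \<inter> cells_event \<Lambda> h s'"
    then show False by (elim IntE) (rule absurd)
  qed
qed

text \<open>
  The probability that no time cell contains two epochs is \<open>cell_prob \<Lambda> h ^ m\<close>, which tends
  to one as the mesh of the cells of \<open>(0, t]\<close> tends to zero.
\<close>

lemma prob_ge_of_cells:
  assumes \<Lambda>: "finite \<Lambda>" "\<Lambda> \<noteq> {}" and t: "0 < t" and A: "A \<in> events" and "0 \<le> v"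
    and cells: "\<And>m s. 0 < m \<Longrightarrow> s \<in> cell_seqs \<Lambda> m \<Longrightarrow>
      prob (cells_event \<Lambda> (t / m) s) * w s \<le> prob (A \<inter> cells_event \<Lambda> (t / m) s)"
    and v: "\<And>m. 0 < m \<Longrightarrow>
      (\<Sum>s\<in>cell_seqs \<Lambda> m. pmf (replicate_pmf m (cell_law \<Lambda> (cell_rate \<Lambda> (t / m)))) s * w s) = v"
  shows "v \<le> prob A"
proof -
  \<comment> \<open>The mean number of epochs in (0, t] on \<Lambda>. Each cell has mean
    \<open>?\<kappa> / m\<close>, so \<open>exp_Bernoulli_bound\<close> loses
    \<open>?\<kappa>\<^sup>2 / m\<close>.\<close>
  let ?\<kappa> = "card \<Lambda> * (r_inf * t)"
  have bound: "(1 - ?\<kappa>\<^sup>2 / m) * v \<le> prob A" if m: "0 < m" for m :: nat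
  proof -
    let ?h = "t / m"
    have h: "0 < ?h" using t m by simp
    have "1 - ?\<kappa>\<^sup>2 / m = 1 - real m * (card \<Lambda> * (r_inf * ?h))\<^sup>2"
      using m by (simp add: power2_eq_square field_simps)
    also have "\<dots> \<le> cell_prob \<Lambda> ?h ^ m"
      unfolding cell_prob_def using t r_inf_positive by (intro exp_Bernoulli_bound) simp
    finally have "(1 - ?\<kappa>\<^sup>2 / m) * v \<le> cell_prob \<Lambda> ?h ^ m * v"
      using \<open>0 \<le> v\<close> by (rule mult_right_mono)
    also have "\<dots> = (\<Sum>s\<in>cell_seqs \<Lambda> m. prob (cells_event \<Lambda> ?h s) * w s)"
      by (simp add: prob_cells_event[OF \<Lambda> h _ m] v[OF m, symmetric] sum_distrib_left mult.assoc)
    also have "\<dots> \<le> (\<Sum>s\<in>cell_seqs \<Lambda> m. prob (A \<inter> cells_event \<Lambda> ?h s))"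
      using cells[OF m] by (intro sum_mono) auto
    also have "\<dots> = prob (\<Union>s\<in>cell_seqs \<Lambda> m. A \<inter> cells_event \<Lambda> ?h s)"
    proof (rule finite_measure_finite_Union[symmetric, OF finite_cell_seqs[OF \<Lambda>(1)]])
      show "disjoint_family_on (\<lambda>s. A \<inter> cells_event \<Lambda> ?h s) (cell_seqs \<Lambda> m)"
        unfolding disjoint_family_on_def using disjoint_cells_event by blast
    qed (use A cells_event_events in blast)
    also have "\<dots> \<le> prob A"
      using A by (intro finite_measure_mono) auto
    finally show ?thesis .
  qed
  have "(\<lambda>m. (1 - ?\<kappa>\<^sup>2 / real m) * v) \<longlonglongrightarrow> (1 - 0) * v"
    by (intro tendsto_intros lim_const_over_n)
  then have "(\<lambda>m. (1 - ?\<kappa>\<^sup>2 / real m) * v) \<longlonglongrightarrow> v" by simp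
  then show ?thesis
    by (rule LIMSEQ_le_const2) (use bound in \<open>auto intro!: exI[of _ 1]\<close>)
qed

lemma AE_cells_event_order:
  assumes "0 < m" "0 < t" "s \<in> cell_seqs \<Lambda> m"
  shows "AE \<omega> in M. \<omega> \<in> cells_event \<Lambda> (t / m) s \<longrightarrow>
    in_temporal_order (\<lambda>x i. T x i \<omega>) (epochs_in \<Lambda> (\<lambda>x i. T x i \<omega>) 0 t) (label_epochs s)"
  using AE_epochs_regular
proof eventually_elim
  case (elim \<omega>)
  show ?case
  proof
    assume E: "\<omega> \<in> cells_event \<Lambda> (t / m) s"
    have "in_temporal_order (\<lambda>x i. T x i \<omega>) (epochs_in \<Lambda> (\<lambda>x i. T x i \<omega>) 0 (real (length s) * (t / m)))
        (label_epochs s)"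
    proof (rule in_temporal_order_label_epochs)
      show "0 < t / m" using assms by simp
      show "set s \<subseteq> insert None (Some ` \<Lambda>)" using assms(3) by (simp add: cell_seqs_def)
      show "card {i. T x i \<omega> \<in> {real j * (t / m)<..real (Suc j) * (t / m)}} = (if s ! j = Some x then 1 else 0)"
        if "x \<in> \<Lambda>" "j < length s" for x j
        using E that unfolding cells_event_def by blast
    qed (use elim in auto)
    then show "in_temporal_order (\<lambda>x i. T x i \<omega>) (epochs_in \<Lambda> (\<lambda>x i. T x i \<omega>) 0 t) (label_epochs s)"
      using assms by (simp add: cell_seqs_def)
  qed
qed

text \<open>Every record supplies an ordered list, and the records have total probability
  arbitrarily close to one. This gives finiteness and distinctness of the epoch times at one stroke,
  by the estimate with constant weight 1.\<close>

lemma AE_order_exists: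
  assumes \<Lambda>: "finite \<Lambda>" "\<Lambda> \<noteq> {}" and t: "0 < t"
  shows "AE \<omega> in M. \<exists>es. in_temporal_order (\<lambda>x i. T x i \<omega>) (epochs_in \<Lambda> (\<lambda>x i. T x i \<omega>) 0 t) es"
proof -
  let ?ord = "\<lambda>\<omega>. in_temporal_order (\<lambda>x i. T x i \<omega>) (epochs_in \<Lambda> (\<lambda>x i. T x i \<omega>) 0 t)"
  have [measurable]: "Measurable.pred M (\<lambda>\<omega>. ?ord \<omega> es)" for es
    by (rule pred_in_temporal_order[OF measurable_ingredients(2) pred_epochs_in])
  have A: "{\<omega> \<in> space M. \<exists>es. ?ord \<omega> es} \<in> events" by measurable
  have "1 \<le> prob {\<omega> \<in> space M. \<exists>es. ?ord \<omega> es}"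
  proof (rule prob_ge_of_cells[OF \<Lambda> t A, where w = "\<lambda>_. 1"])
    fix m s assume ms: "0 < m" "s \<in> cell_seqs \<Lambda> m"
    have "prob (cells_event \<Lambda> (t / real m) s) \<le> prob ({\<omega> \<in> space M. \<exists>es. ?ord \<omega> es} \<inter> cells_event \<Lambda> (t / real m) s)"
      using AE_cells_event_order[OF ms(1) t ms(2)] cells_event_events A
      by (intro finite_measure_mono_AE) (auto elim!: eventually_mono)
    then show "prob (cells_event \<Lambda> (t / real m) s) * 1 \<le>
        prob ({\<omega> \<in> space M. \<exists>es. ?ord \<omega> es} \<inter> cells_event \<Lambda> (t / real m) s)" by simp
  next
    fix m :: nat
    show "(\<Sum>s\<in>cell_seqs \<Lambda> m. pmf (replicate_pmf m (cell_law \<Lambda> (cell_rate \<Lambda> (t / real m)))) s * 1) = 1"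
      using sum_pmf_eq_1[OF finite_cell_seqs[OF \<Lambda>(1)] set_pmf_replicate_cell_law[OF \<Lambda>]] by simp
  qed simp
  then have "prob {\<omega> \<in> space M. \<exists>es. ?ord \<omega> es} = 1"
    using prob_le_1 by (simp add: antisym)
  then show ?thesis
    using A by (simp add: prob_Collect_eq_1)
qed

text \<open>Given the record s, the process is almost surely a fold over the fixed list
  \<open>label_epochs s\<close>, whose sites are the nonempty entries of s. The resulting weights
  \<open>?w s\<close> average to the box law by \<open>box_law_cells_invariant\<close>.\<close>

lemma prob_box_process_ge:
  assumes \<Lambda>: "finite \<Lambda>" "\<Lambda> \<noteq> {}" and t: "0 < t"
  shows "pmf (box_law \<Lambda>) \<xi> \<le> prob {\<omega> \<in> space M. box_process \<Lambda> t \<omega> = \<xi>}"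
proof -
  let ?A = "{\<omega> \<in> space M. box_process \<Lambda> t \<omega> = \<xi>}"
  let ?w = "\<lambda>s. pmf (box_law \<Lambda> \<bind> site_kernel \<Lambda> (map the (filter (\<lambda>z. z \<noteq> None) s))) \<xi>"
  have A: "?A \<in> events"
    using pred_config_eq[OF measurable_box_process] by (simp add: pred_def)
  show ?thesis
  proof (rule prob_ge_of_cells[OF \<Lambda> t A, where w = ?w])
    fix m s assume ms: "0 < m" "s \<in> cell_seqs \<Lambda> m"
    let ?E = "cells_event \<Lambda> (t / real m) s"
    let ?B = "{\<omega> \<in> space M. box_fold \<Lambda> (label_epochs s) (box_config \<Lambda> \<omega>) \<omega> = \<xi>}"
    have B: "?B \<in> events" by (rule box_fold_eq_event[OF measurable_box_config])
    have "emeasure M ?E * ennreal (?w s) \<le> emeasure M (?E \<inter> ?B)"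
      using emeasure_box_fold_initial[OF \<Lambda>(1) cells_event_info distinct_label_epochs]
      by (simp only: map_fst_label_epochs)
    then have "prob ?E * ?w s \<le> prob (?E \<inter> ?B)"
      by (simp add: emeasure_eq_measure ennreal_mult[symmetric])
    also have "\<dots> \<le> prob (?A \<inter> ?E)"
    proof (rule finite_measure_mono_AE)
      show "AE \<omega> in M. \<omega> \<in> ?E \<inter> ?B \<longrightarrow> \<omega> \<in> ?A \<inter> ?E"
        using AE_cells_event_order[OF ms(1) t ms(2)]
        by eventually_elim (auto simp: box_process_def box_fold_def run_epochs_eq)
    qed (use A cells_event_events in auto)
    finally show "prob ?E * ?w s \<le> prob (?A \<inter> ?E)" .
  next
    fix m :: nat
    let ?R = "replicate_pmf m (cell_law \<Lambda> (cell_rate \<Lambda> (t / real m)))"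
    have "(\<Sum>s\<in>cell_seqs \<Lambda> m. pmf ?R s * ?w s) =
        pmf (?R \<bind> (\<lambda>s. box_law \<Lambda> \<bind> site_kernel \<Lambda> (map the (filter (\<lambda>z. z \<noteq> None) s)))) \<xi>"
      unfolding pmf_bind[of ?R]
      using set_pmf_replicate_cell_law[OF \<Lambda>]
      by (subst integral_measure_pmf[OF finite_cell_seqs[OF \<Lambda>(1), of m]]) auto
    also have "\<dots> = pmf (box_law \<Lambda>) \<xi>"
      using box_law_cells_invariant[OF \<Lambda>] by simp
    finally show "(\<Sum>s\<in>cell_seqs \<Lambda> m. pmf ?R s * ?w s) = pmf (box_law \<Lambda>) \<xi>" .
  qed simp
qed

lemma prob_box_process:
  assumes \<Lambda>: "finite \<Lambda>" "\<Lambda> \<noteq> {}" and t: "0 < t"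
    and A: "{\<omega> \<in> space M. box_process \<Lambda> t \<omega> \<in> A} \<in> events"
  shows "prob {\<omega> \<in> space M. box_process \<Lambda> t \<omega> \<in> A} = measure_pmf.prob (box_law \<Lambda>) A"
proof -
  have ge: "measure_pmf.prob (box_law \<Lambda>) A \<le> prob {\<omega> \<in> space M. box_process \<Lambda> t \<omega> \<in> A}"
    if A: "{\<omega> \<in> space M. box_process \<Lambda> t \<omega> \<in> A} \<in> events" for A
  proof -
    \<comment> \<open>The box law lives on a countable set, so the bounds at single configurations
      can be summed.\<close>
    let ?C = "A \<inter> set_pmf (box_law \<Lambda>)"
    let ?X = "\<lambda>\<xi>. {\<omega> \<in> space M. box_process \<Lambda> t \<omega> = \<xi>}"
    have X: "?X \<xi> \<in> events" for \<xi>
      using pred_config_eq[OF measurable_box_process] by (simp add: pred_def)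
    have "emeasure (box_law \<Lambda>) A = emeasure (box_law \<Lambda>) ?C"
      by (simp add: emeasure_Int_set_pmf)
    also have "\<dots> = (\<integral>\<^sup>+\<xi>. ennreal (pmf (box_law \<Lambda>) \<xi>) \<partial>count_space ?C)"
      by (rule nn_integral_pmf[symmetric])
    also have "\<dots> \<le> (\<integral>\<^sup>+\<xi>. emeasure M (?X \<xi>) \<partial>count_space ?C)"
      using prob_box_process_ge[OF \<Lambda> t] by (intro nn_integral_mono) (simp add: emeasure_eq_measure)
    also have "\<dots> = emeasure M (\<Union>\<xi>\<in>?C. ?X \<xi>)"
      using X by (intro emeasure_UN_countable[symmetric]) (auto simp: disjoint_family_on_def)
    also have "\<dots> \<le> emeasure M {\<omega> \<in> space M. box_process \<Lambda> t \<omega> \<in> A}"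
      using A by (intro emeasure_mono) auto
    finally show ?thesis by (simp add: emeasure_eq_measure measure_pmf.emeasure_eq_measure)
  qed
  have neg: "prob {\<omega> \<in> space M. box_process \<Lambda> t \<omega> \<in> - A} = 1 - prob {\<omega> \<in> space M. box_process \<Lambda> t \<omega> \<in> A}"
    using prob_neg[of "\<lambda>\<omega>. box_process \<Lambda> t \<omega> \<in> A"] A by simp
  have "{\<omega> \<in> space M. box_process \<Lambda> t \<omega> \<in> - A} = space M - {\<omega> \<in> space M. box_process \<Lambda> t \<omega> \<in> A}"
    by auto
  then have "{\<omega> \<in> space M. box_process \<Lambda> t \<omega> \<in> - A} \<in> events" using A by auto
  from ge[OF this] have "1 - measure_pmf.prob (box_law \<Lambda>) A \<le> 1 - prob {\<omega> \<in> space M. box_process \<Lambda> t \<omega> \<in> A}"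
    unfolding neg using measure_pmf.prob_compl[of A "box_law \<Lambda>"] by (simp add: Compl_eq_Diff_UNIV)
  then show ?thesis using ge[OF A] by simp
qed

end

section \<open>The law of the zero-range process\<close>

context zrp_setup
begin

text \<open>All that the graph of a block uses of the epochs: one mark per site.\<close>

definition occupied :: "nat \<Rightarrow> 'w \<Rightarrow> (int ^ 'd) \<Rightarrow> bool" where
  "occupied k \<omega> x \<longleftrightarrow> (\<exists>i. T x i \<omega> \<in> {real k * t0..real (Suc k) * t0})"

lemma measurable_occupied: "(\<lambda>\<omega>. occupied k \<omega> x) \<in> measurable M (count_space UNIV)"
  unfolding occupied_def by measurable

lemma prob_not_occupied: "prob {\<omega> \<in> space M. \<not> occupied k \<omega> x} = exp (- (r_inf * t0))"
proof -
  \<comment> \<open>The Poisson law concerns subsets of the open half-line, so the first block loses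
    its endpoint 0; epochs are almost surely positive.\<close>
  define B where "B = (if k = 0 then {0<..t0} else {real k * t0..real (Suc k) * t0})"
  have B: "B \<in> sets borel" "B \<subseteq> {0<..}" "bounded B"
  proof -
    have "{real k * t0..real (Suc k) * t0} \<subseteq> {0<..}" if "k \<noteq> 0"
    proof
      fix s assume "s \<in> {real k * t0..real (Suc k) * t0}"
      moreover have "0 < real k * t0" using that t0_pos by simp
      ultimately show "s \<in> {0<..}" by auto
    qed
    then show "B \<subseteq> {0<..}" by (auto simp: B_def)
  qed (auto simp: B_def bounded_Ioc)
  have len: "measure lborel B = t0"
    using t0_pos by (simp add: B_def algebra_simps)
  have "\<forall>B\<in>sets borel. B \<subseteq> {0<..} \<longrightarrow> bounded B \<longrightarrow>
      (\<forall>k. prob {\<omega> \<in> space M. card {i. T x i \<omega> \<in> B} = k} =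
         (r_inf * measure lborel B) ^ k / fact k * exp (- (r_inf * measure lborel B)))"
    using poisson_epochs[of x, unfolded poisson_point_process_def] by (elim conjE)
  then have "prob {\<omega> \<in> space M. card {i. T x i \<omega> \<in> B} = 0} =
      (r_inf * measure lborel B) ^ 0 / fact 0 * exp (- (r_inf * measure lborel B))"
    using B by blast
  then have "prob {\<omega> \<in> space M. card {i. T x i \<omega> \<in> B} = 0} = exp (- (r_inf * t0))"
    by (simp add: len)
  moreover have "prob {\<omega> \<in> space M. \<not> occupied k \<omega> x} = prob {\<omega> \<in> space M. card {i. T x i \<omega> \<in> B} = 0}"
  proof (rule measure_eq_AE)
    have [measurable]: "(\<lambda>\<omega>. card {i. T x i \<omega> \<in> B}) \<in> measurable M (count_space UNIV)"
      using B(1) by measurable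
    show "{\<omega> \<in> space M. card {i. T x i \<omega> \<in> B} = 0} \<in> events" by measurable
    show "{\<omega> \<in> space M. \<not> occupied k \<omega> x} \<in> events"
      using measurable_occupied[of k x] by measurable
    show "AE \<omega> in M. \<omega> \<in> {\<omega> \<in> space M. \<not> occupied k \<omega> x} \<longleftrightarrow>
        \<omega> \<in> {\<omega> \<in> space M. card {i. T x i \<omega> \<in> B} = 0}"
      using AE_epochs_regular
    proof eventually_elim
      case (elim \<omega>)
      then have mono: "mono (\<lambda>i. T x i \<omega>)" and pos: "0 < T x 0 \<omega>"
        and lim: "filterlim (\<lambda>i. T x i \<omega>) at_top sequentially"
        by (auto intro: strict_mono_mono)
      have pos': "0 < T x i \<omega>" for i
        using pos monoD[OF mono, of 0 i] by simp
      have "eventually (\<lambda>i. real (Suc k) * t0 < T x i \<omega>) sequentially"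
        using lim unfolding filterlim_at_top_dense by blast
      then obtain n where n: "\<And>i. n \<le> i \<Longrightarrow> real (Suc k) * t0 < T x i \<omega>"
        by (auto simp: eventually_sequentially)
      \<comment> \<open>Finiteness rules out that the count is 0 only because \<open>card\<close> is
        0 on infinite sets.\<close>
      have "{i. T x i \<omega> \<in> B} \<subseteq> {..<n}"
      proof
        fix i assume "i \<in> {i. T x i \<omega> \<in> B}"
        then have "T x i \<omega> \<le> real (Suc k) * t0" by (auto simp: B_def split: if_splits)
        then show "i \<in> {..<n}" using n[of i] by (cases "n \<le> i") auto
      qed
      then have "finite {i. T x i \<omega> \<in> B}" by (rule finite_subset) simp
      moreover have "T x i \<omega> \<in> B \<longleftrightarrow> T x i \<omega> \<in> {real k * t0..real (Suc k) * t0}" for i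
        using pos'[of i] by (auto simp: B_def)
      ultimately show ?case by (simp add: occupied_def)
    qed
  qed
  ultimately show ?thesis by simp
qed

lemma distr_occupied:
  "distr M (count_space UNIV) (\<lambda>\<omega>. occupied k \<omega> x) = distr M (count_space UNIV) (\<lambda>\<omega>. occupied 0 \<omega> x)"
proof -
  have pr: "prob {\<omega> \<in> space M. occupied k \<omega> x = b} = prob {\<omega> \<in> space M. occupied 0 \<omega> x = b}" for b
  proof (cases b)
    case True
    have ev: "{\<omega> \<in> space M. \<not> occupied k \<omega> x} \<in> events" for k
      using measurable_occupied[of k x] by measurable
    have "prob {\<omega> \<in> space M. occupied k \<omega> x} = 1 - prob {\<omega> \<in> space M. \<not> occupied k \<omega> x}" for k
      using prob_neg[OF ev] by simp
    then show ?thesis using True by (simp add: prob_not_occupied)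
  next
    case False
    then show ?thesis by (simp add: prob_not_occupied)
  qed
  show ?thesis
  proof (rule measure_eqI_countable[where A = UNIV])
    fix b :: bool
    have "emeasure (distr M (count_space UNIV) (\<lambda>\<omega>. occupied k \<omega> x)) {b} =
        ennreal (prob {\<omega> \<in> space M. occupied k \<omega> x = b})" for k
      using measurable_occupied[of k x]
      by (subst emeasure_distr) (auto simp: emeasure_eq_measure vimage_def Int_def conj_commute)
    then show "emeasure (distr M (count_space UNIV) (\<lambda>\<omega>. occupied k \<omega> x)) {b} =
        emeasure (distr M (count_space UNIV) (\<lambda>\<omega>. occupied 0 \<omega> x)) {b}"
      using pr[of b] by simp
  qed auto
qed

lemma distr_occupied_PiM:
  "distr M (\<Pi>\<^sub>M x\<in>UNIV. count_space UNIV) (occupied k) =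
     (\<Pi>\<^sub>M x\<in>UNIV. distr M (count_space UNIV) (\<lambda>\<omega>. occupied k \<omega> x))"
proof -
  have "indep_vars (\<lambda>_. count_space UNIV) (\<lambda>x \<omega>. occupied k \<omega> x) UNIV"
    unfolding indep_vars_def2
  proof (intro conjI ballI measurable_occupied indep_sets_mono_sets[OF indep_epochs] subsetI)
    fix x A
    assume "A \<in> {(\<lambda>\<omega>. occupied k \<omega> x) -` B \<inter> space M |B. B \<in> sets (count_space UNIV)}"
    then obtain B where A: "A = (\<lambda>\<omega>. occupied k \<omega> x) -` B \<inter> space M" by blast
    let ?V = "vimage_algebra (space M) (\<lambda>\<omega> i. T x i \<omega>) (\<Pi>\<^sub>M i\<in>(UNIV :: nat set). (borel :: real measure))"
    have V: "(\<lambda>\<omega> i. T x i \<omega>) \<in> measurable ?V (\<Pi>\<^sub>M i\<in>UNIV. borel)"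
      by (rule measurable_vimage_algebra1) (auto simp: space_PiM)
    have [measurable]: "T x i \<in> borel_measurable ?V" for i
      using measurable_compose[OF V measurable_component_singleton[of i]] by simp
    have "(\<lambda>\<omega>. occupied k \<omega> x) \<in> measurable ?V (count_space UNIV)"
      unfolding occupied_def by measurable
    from measurable_sets[OF this, of B] show "A \<in> ingredient_events M \<eta>0 T U Y (Epochs x)"
      by (simp only: A ingredient_events.simps space_vimage_algebra) simp
  qed
  then show ?thesis
    using indep_vars_iff_distr_eq_PiM[where I = UNIV and M' = "\<lambda>_. count_space UNIV" and
        X = "\<lambda>x \<omega>. occupied k \<omega> x", OF _ measurable_occupied]
    by (simp add: restrict_def)
qed

text \<open>The component as a function of the marks, so that finiteness becomes an event in their
  product space.\<close>

definition occupied_component :: "(int ^ 'd \<Rightarrow> bool) \<Rightarrow> int ^ 'd \<Rightarrow> (int ^ 'd) set" where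
  "occupied_component v x = {y. (\<lambda>x y. (x - y \<in> \<N> \<or> y - x \<in> \<N>) \<and> (v x \<or> v y))\<^sup>*\<^sup>* x y}"

lemma component_eq_occupied_component:
  "component \<N> (\<lambda>x i. T x i \<omega>) (real k * t0) (real (Suc k) * t0) x = occupied_component (occupied k \<omega>) x"
proof -
  have "joined \<N> (\<lambda>x i. T x i \<omega>) (real k * t0) (real (Suc k) * t0) =
      (\<lambda>x y. (x - y \<in> \<N> \<or> y - x \<in> \<N>) \<and> (occupied k \<omega> x \<or> occupied k \<omega> y))"
    by (intro ext) (auto simp: joined_def occupied_def)
  then show ?thesis by (simp add: component_def occupied_component_def)
qed

lemma pred_finite_occupied_components:
  "Measurable.pred (\<Pi>\<^sub>M x\<in>UNIV. count_space UNIV) (\<lambda>v. \<forall>x. finite (occupied_component v x))"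
proof -
  let ?P = "\<Pi>\<^sub>M x\<in>(UNIV :: (int ^ 'd) set). count_space (UNIV :: bool set)"
  have v [measurable]: "Measurable.pred ?P (\<lambda>v. v x)" for x
    using measurable_component_singleton[of x UNIV "\<lambda>_. count_space UNIV"] by simp
  have [measurable]: "Measurable.pred ?P (\<lambda>v. y \<in> occupied_component v x)" for x y
    unfolding occupied_component_def mem_Collect_eq by (rule pred_component) measurable
  \<comment> \<open>Lists are countable in number, so this form expresses finiteness by countable
    operations.\<close>
  have "finite S \<longleftrightarrow> (\<exists>F::(int ^ 'd) list. \<forall>y. y \<in> S \<longrightarrow> y \<in> set F)" for S :: "(int ^ 'd) set"
    by (metis finite_list finite_set finite_subset subsetI)
  then show ?thesis by simp
qed

text \<open>Equality of the laws of the marks moves the almost sure event from block 0 to block k;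
  the blocks are then joined by a countable intersection, whatever the dependence between
  them.\<close>

lemma AE_components_finite:
  "AE \<omega> in M. \<forall>k x. finite (component \<N> (\<lambda>x i. T x i \<omega>) (real k * t0) (real (Suc k) * t0) x)"
proof -
  let ?P = "\<Pi>\<^sub>M x\<in>(UNIV :: (int ^ 'd) set). count_space (UNIV :: bool set)"
  let ?fin = "\<lambda>v. \<forall>x. finite (occupied_component v x)"
  have occ: "occupied k \<in> measurable M ?P" for k
    by (intro measurable_PiM_single') (auto simp: measurable_occupied)
  have law: "distr M ?P (occupied k) = distr M ?P (occupied 0)" for k
    unfolding distr_occupied_PiM distr_occupied[of k] by (rule refl)
  have ev: "{v \<in> space ?P. ?fin v} \<in> sets ?P"
    using pred_finite_occupied_components by (simp add: pred_def)
  have "AE \<omega> in M. ?fin (occupied 0 \<omega>)"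
    using finite_components component_eq_occupied_component[where k = 0] by simp
  then have "AE v in distr M ?P (occupied k). ?fin v" for k
    unfolding law[of k] by (subst AE_distr_iff[OF occ ev])
  then have "AE \<omega> in M. ?fin (occupied k \<omega>)" for k
    by (simp only: AE_distr_iff[OF occ ev])
  then have "AE \<omega> in M. \<forall>k. ?fin (occupied k \<omega>)"
    by (simp only: AE_all_countable) blast
  then show ?thesis by (simp only: component_eq_occupied_component)
qed

section \<open>Passage to infinite volume\<close>

text \<open>\<open>box_shift\<close> works on finite sets of any shape, so an enumeration of the
  sites already provides a suitable exhaustion.\<close>

definition sites_upto :: "nat \<Rightarrow> (int ^ 'd) set" where
  "sites_upto L = from_nat ` {..L}"

lemma finite_sites_upto: "finite (sites_upto L)" and sites_upto_nonempty: "sites_upto L \<noteq> {}"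
  by (auto simp: sites_upto_def)

lemma eventually_sites_upto: "eventually (\<lambda>L. x \<in> sites_upto L) sequentially"
  unfolding eventually_sequentially
proof (intro exI allI impI)
  fix L assume "to_nat x \<le> L"
  then show "x \<in> sites_upto L"
    unfolding sites_upto_def by (intro image_eqI[of x from_nat "to_nat x"]) auto
qed

definition process :: "real \<Rightarrow> 'w \<Rightarrow> (int ^ 'd \<Rightarrow> nat)" where
  "process t \<omega> = zrp t0 \<N> r \<alpha> (\<lambda>x i. T x i \<omega>) (\<lambda>x i. U x i \<omega>) (\<lambda>x i. Y x i \<omega>) (\<eta>0 \<omega>) t"

lemma measurable_process: "process t \<in> measurable M config_space"
  unfolding process_def[abs_def] by (rule measurable_zrp) (rule measurable_ingredients)+

lemma AE_box_process_eventually_eq: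
  assumes "0 \<le> t"
  shows "AE \<omega> in M. \<forall>x. eventually (\<lambda>L. box_process (sites_upto L) t \<omega> x = process t \<omega> x) sequentially"
proof -
  \<comment> \<open>Integer times keep the exceptional sets countable in number; a temporal order up
    to a later time restricts to every real time before it.\<close>
  have "AE \<omega> in M. \<forall>L n. \<exists>es. in_temporal_order (\<lambda>x i. T x i \<omega>)
      (epochs_in (sites_upto L) (\<lambda>x i. T x i \<omega>) 0 (real (Suc n))) es"
    unfolding AE_all_countable
    by (intro allI AE_order_exists finite_sites_upto sites_upto_nonempty) simp
  then show ?thesis
    using AE_displacement AE_components_finite
  proof eventually_elim
    case (elim \<omega>)
    have ord: "\<exists>es. in_temporal_order (\<lambda>x i. T x i \<omega>) (epochs_in (sites_upto L) (\<lambda>x i. T x i \<omega>) 0 s) es" for L s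
    proof -
      obtain es where es: "in_temporal_order (\<lambda>x i. T x i \<omega>)
          (epochs_in (sites_upto L) (\<lambda>x i. T x i \<omega>) 0 (real (Suc (nat \<lceil>s\<rceil>)))) es"
        using elim(1) by blast
      have "s \<le> real (Suc (nat \<lceil>s\<rceil>))" by linarith
      then have "epochs_in (sites_upto L) (\<lambda>x i. T x i \<omega>) 0 s \<subseteq>
          epochs_in (sites_upto L) (\<lambda>x i. T x i \<omega>) 0 (real (Suc (nat \<lceil>s\<rceil>)))"
        by (auto simp: epochs_in_def)
      then show ?thesis by (rule in_temporal_order_subset[OF es])
    qed
    have init: "eventually (\<lambda>L. box_config (sites_upto L) \<omega> x = \<eta>0 \<omega> x) sequentially" for x
      using eventually_sites_upto[of x] by eventually_elim (simp add: box_config_def)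
    show ?case
      unfolding box_process_def process_def
      by (intro allI box_run_eventually_eq_zrp finite_sites_upto eventually_sites_upto finite_range(1)
          ord init t0_pos assms) (use elim(2,3) in blast)+
  qed
qed

lemma prob_box_process_cylinder:
  assumes \<Lambda>: "finite \<Lambda>" "\<Lambda> \<noteq> {}" and t: "0 < t" and J: "J \<subseteq> \<Lambda>"
  shows "prob {\<omega> \<in> space M. \<forall>x\<in>J. box_process \<Lambda> t \<omega> x \<in> A x} =
    (\<Prod>x\<in>J. measure_pmf.prob (marg x) (A x))"
proof -
  have fin: "finite J" using J \<Lambda>(1) finite_subset by blast
  have [measurable]: "(\<lambda>\<omega>. box_process \<Lambda> t \<omega> x) \<in> measurable M (count_space UNIV)" for x
    by (rule measurable_config_spaceD[OF measurable_box_process])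
  let ?A = "{\<eta>. \<forall>x\<in>J. \<eta> x \<in> A x}" and ?B = "\<lambda>x. if x \<in> J then A x else UNIV"
  have "{\<omega> \<in> space M. box_process \<Lambda> t \<omega> \<in> ?A} \<in> events"
    using fin by simp
  from prob_box_process[OF \<Lambda> t this]
  have "prob {\<omega> \<in> space M. \<forall>x\<in>J. box_process \<Lambda> t \<omega> x \<in> A x} = measure_pmf.prob (box_law \<Lambda>) ?A"
    by simp
  also have "?A = Pi \<Lambda> ?B" using J by (auto simp: Pi_def)
  also have "measure_pmf.prob (box_law \<Lambda>) (Pi \<Lambda> ?B) = (\<Prod>x\<in>\<Lambda>. measure_pmf.prob (marg x) (?B x))"
    unfolding box_law_def by (rule measure_Pi_pmf_Pi[OF \<Lambda>(1)])
  also have "\<dots> = (\<Prod>x\<in>J. measure_pmf.prob (marg x) (?B x))"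
    using J \<Lambda>(1) by (intro prod.mono_neutral_right) auto
  finally show ?thesis by simp
qed

text \<open>A cylinder event looks at finitely many sites, so almost surely its indicator for the
  box process is eventually equal to the one for the true process, and dominated convergence
  applies. The probabilities for the boxes are constant once the box contains
  \<open>J\<close>.\<close>

lemma prob_process_cylinder:
  assumes t: "0 < t" and J: "finite J"
  shows "prob {\<omega> \<in> space M. \<forall>x\<in>J. process t \<omega> x \<in> A x} = (\<Prod>x\<in>J. measure_pmf.prob (marg x) (A x))"
proof -
  define E where "E L = {\<omega> \<in> space M. \<forall>x\<in>J. box_process (sites_upto L) t \<omega> x \<in> A x}" for L
  define F where "F = {\<omega> \<in> space M. \<forall>x\<in>J. process t \<omega> x \<in> A x}"
  have [measurable]: "(\<lambda>\<omega>. box_process (sites_upto L) t \<omega> x) \<in> measurable M (count_space UNIV)" for L x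
    by (rule measurable_config_spaceD[OF measurable_box_process])
  have [measurable]: "(\<lambda>\<omega>. process t \<omega> x) \<in> measurable M (count_space UNIV)" for x
    by (rule measurable_config_spaceD[OF measurable_process])
  have E: "E L \<in> events" for L unfolding E_def using J by simp
  have F: "F \<in> events" unfolding F_def using J by simp
  have "(\<lambda>L. expectation (indicat_real (E L))) \<longlonglongrightarrow> expectation (indicat_real F)"
  proof (rule integral_dominated_convergence[where w = "\<lambda>_. 1"])
    show "AE \<omega> in M. (\<lambda>L. indicat_real (E L) \<omega>) \<longlonglongrightarrow> indicat_real F \<omega>"
      using AE_box_process_eventually_eq[OF less_imp_le[OF t]]
    proof eventually_elim
      case (elim \<omega>)
      have "eventually (\<lambda>L. \<forall>x\<in>J. box_process (sites_upto L) t \<omega> x = process t \<omega> x) sequentially"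
        using elim J by (intro eventually_ball_finite) auto
      then have "eventually (\<lambda>L. indicat_real (E L) \<omega> = indicat_real F \<omega>) sequentially"
        by eventually_elim (auto simp: E_def F_def indicator_def)
      then show ?case by (rule tendsto_eventually)
    qed
  qed (use E F in \<open>auto simp: indicator_def\<close>)
  then have "(\<lambda>L. prob (E L)) \<longlonglongrightarrow> prob F" using E F by simp
  moreover have "eventually (\<lambda>L. prob (E L) = (\<Prod>x\<in>J. measure_pmf.prob (marg x) (A x))) sequentially"
  proof -
    have "eventually (\<lambda>L. \<forall>x\<in>J. x \<in> sites_upto L) sequentially"
      using J eventually_sites_upto by (intro eventually_ball_finite) auto
    then show ?thesis
      by eventually_elim
        (auto simp: E_def intro!: prob_box_process_cylinder finite_sites_upto sites_upto_nonempty t)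
  qed
  then have "(\<lambda>L. prob (E L)) \<longlonglongrightarrow> (\<Prod>x\<in>J. measure_pmf.prob (marg x) (A x))"
    by (rule tendsto_eventually)
  ultimately show ?thesis unfolding F_def by (rule LIMSEQ_unique)
qed

lemma process_0: "process 0 \<omega> = \<eta>0 \<omega>"
proof -
  have empty: "{(y, i). y \<in> C \<and> T y i \<omega> \<in> {0<..0}} = {}" for C by auto
  have "in_temporal_order (\<lambda>x i. T x i \<omega>) {} []" by (simp add: in_temporal_order_def)
  from run_epochs_eq[OF this] show ?thesis
    unfolding process_def zrp_def Let_def by (intro ext) (simp add: zrp_step_eq_run_epochs empty)
qed

lemma distr_process:
  assumes "0 \<le> t"
  shows "distr M config_space (process t) = zrp_product_measure r \<alpha> \<phi>"
proof (cases "t = 0")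
  case True
  then show ?thesis using initial_law by (simp add: process_0[abs_def])
next
  case False
  then have t: "0 < t" using assms by simp
  let ?P = "\<Pi>\<^sub>M x\<in>UNIV. measure_pmf (marg x)"
  have P: "zrp_product_measure r \<alpha> \<phi> = ?P"
    by (simp add: zrp_product_measure_def site_marginal_eq_marg)
  have sets: "sets config_space = sets ?P"
    unfolding config_space_def by (intro sets_PiM_cong) auto
  show ?thesis
    unfolding P
  proof (rule measure_eqI_PiM_infinite)
    fix A and J :: "(int ^ 'd) set" assume J: "finite J"
    let ?E = "prod_emb UNIV (\<lambda>x. measure_pmf (marg x)) J (Pi\<^sub>E J A)"
    have E: "?E \<in> sets config_space"
      unfolding sets using J by (intro sets_PiM_I) auto
    have mem: "\<eta> \<in> ?E \<longleftrightarrow> (\<forall>x\<in>J. \<eta> x \<in> A x)" for \<eta>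
      by (auto simp: prod_emb_def space_PiM PiE_iff)
    have "emeasure (distr M config_space (process t)) ?E =
        ennreal (prob {\<omega> \<in> space M. \<forall>x\<in>J. process t \<omega> x \<in> A x})"
      using E by (subst emeasure_distr[OF measurable_process])
        (auto simp: emeasure_eq_measure mem intro!: arg_cong[where f = prob])
    also have "\<dots> = (\<Prod>x\<in>J. emeasure (measure_pmf (marg x)) (A x))"
      by (simp add: prob_process_cylinder[OF t J] measure_pmf.emeasure_eq_measure prod_ennreal)
    also have "\<dots> = emeasure ?P ?E"
      using J by (intro emeasure_PiM_emb[symmetric]) (auto intro: measure_pmf.prob_space_axioms)
    finally show "emeasure (distr M config_space (process t)) ?E = emeasure ?P ?E" .
  next
    show "finite_measure (distr M config_space (process t))"
      by (intro finite_measure_distr measurable_process)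
  qed (simp_all add: sets)
qed

end

theorem proposition1:
  fixes c r_inf \<phi> t0 t :: real
    and p :: "(int ^ 'd::finite) pmf"
    and \<N> :: "(int ^ 'd) set"
    and r :: "nat \<Rightarrow> real"
    and \<alpha> :: "int ^ 'd \<Rightarrow> real"
    and M :: "'w measure"
    and \<eta>0 :: "'w \<Rightarrow> (int ^ 'd \<Rightarrow> nat)"
    and T U :: "int ^ 'd \<Rightarrow> nat \<Rightarrow> 'w \<Rightarrow> real"
    and Y :: "int ^ 'd \<Rightarrow> nat \<Rightarrow> 'w \<Rightarrow> int ^ 'd"
  assumes "0 < c" "c \<le> 1"
    and "finite \<N>" "set_pmf p \<subseteq> \<N>"
    and "r 0 = 0" "0 < r 1" "\<And>k. 1 \<le> k \<Longrightarrow> r k \<le> r (Suc k)" "r \<longlonglongrightarrow> r_inf"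
    and "\<And>x. \<alpha> x \<in> {c..1}"
    and "\<phi> \<in> {0..<r_inf * c}"
    and "zrp_randomness M r_inf p \<eta>0 T U Y"
    and "0 < t0"
    and "AE \<omega> in M. \<forall>x. finite (component \<N> (\<lambda>x i. T x i \<omega>) 0 t0 x)"
    and "distr M config_space \<eta>0 = zrp_product_measure r \<alpha> \<phi>"
    and "0 \<le> t"
  defines "\<eta> \<equiv> \<lambda>t \<omega>. zrp t0 \<N> r \<alpha> (\<lambda>x i. T x i \<omega>) (\<lambda>x i. U x i \<omega>) (\<lambda>x i. Y x i \<omega>) (\<eta>0 \<omega>) t"
  shows "\<eta> t \<in> measurable M config_space \<and>
    distr M config_space (\<eta> t) = zrp_product_measure r \<alpha> \<phi>"
proof -
  have "prob_space M"
    using assms(11) by (simp only: zrp_randomness_def)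
  then interpret zrp_setup M c r_inf \<phi> t0 p \<N> r \<alpha> \<eta>0 T U Y
    using assms by (simp add: zrp_setup_def zrp_setup_axioms_def)
  have "\<eta> t = process t" by (simp add: \<eta>_def process_def fun_eq_iff)
  then show ?thesis using measurable_process distr_process[OF \<open>0 \<le> t\<close>] by simp
qed

end
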